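(* For every integer $m>6C^2(C+1)$, $$R_m=\begin{cases} m-2 & \text{if } m\not\equiv 2 \pmod 3,\\ m-3 & \text{if } m\equiv 2\pmod 3.\end{cases}$$
   Context: For an integer $m\ge 3$ and $x\in\mathbb Z$ put $P_m(x)=\frac{m-2}{2}x^2-\frac{m-4}{2}x$ (generalized $m$-gonal numbers). An $m$-gonal form of rank $n$ is $F_m(\mathbf x)=a_1P_m(x_1)+\cdots+a_nP_m(x_n)$ with positive integers $a_1\le a_2\le\cdots\le a_n$ and integer variables $x_i\in\mathbb Z$. It represents $N\in\mathbb N$ if $F_m(\mathbf x)=N$ has a solution $\mathbf x\in\mathbb Z^n$; it is universal if it represents every positive integer. The truant of a non-universal form is the smallest positive integer it does not represent (the empty form of rank $0$ represents nothing, so its truant is $1$). The escalator tree of $m$-gonal forms is the rooted tree whose root is the empty form; a node $\sum_{i=1}^k a_iP_m(x_i)$ that is universal is a leaf, and a non-universal node has as children exactly all forms $\sum_{i=1}^{k+1}a_iP_m(x_i)$ with $a_{k+1}\ge a_k$ (any $a_1\ge1$ if $k=0$) that represent the truant of the node. $r_m$ denotes the minimal rank of a leaf of this tree and $R_m$ the maximal rank of a leaf. Standing assumption: $C$ is a fixed absolute constant such that for every $m\ge3$, every $m$-gonal form that represents every positive integer in $[1,C(m-2)]$ is universal. *)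

theory Defs
  imports Complex_Main
begin

text \<open>Generalized m-gonal numbers P_m(x) = ((m-2)x^2 - (m-4)x)/2. The numerator
  (m-2)(x^2-x) + 2x is always even, so integer division by 2 is exact.\<close>
definition polyg :: "nat \<Rightarrow> int \<Rightarrow> int" where
  "polyg m x = ((int m - 2) * x^2 - (int m - 4) * x) div 2"

definition is_form :: "nat list \<Rightarrow> bool" where
  "is_form a \<longleftrightarrow> (\<forall>i\<in>set a. 1 \<le> i) \<and> sorted a"

definition form_val :: "nat \<Rightarrow> nat list \<Rightarrow> int list \<Rightarrow> int" where
  "form_val m a xs = (\<Sum>i<length a. int (a ! i) * polyg m (xs ! i))"

definition represents :: "nat \<Rightarrow> nat list \<Rightarrow> nat \<Rightarrow> bool" where
  "represents m a N \<longleftrightarrow> (\<exists>xs. length xs = length a \<and> form_val m a xs = int N)"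

definition universal :: "nat \<Rightarrow> nat list \<Rightarrow> bool" where
  "universal m a \<longleftrightarrow> (\<forall>N. 1 \<le> N \<longrightarrow> represents m a N)"

definition truant :: "nat \<Rightarrow> nat list \<Rightarrow> nat" where
  "truant m a = (LEAST N. 1 \<le> N \<and> \<not> represents m a N)"

inductive esc_node :: "nat \<Rightarrow> nat list \<Rightarrow> bool" for m where
  root: "esc_node m []"
| child: "\<lbrakk> esc_node m a; \<not> universal m a; 1 \<le> b; a = [] \<or> last a \<le> b;
            represents m (a @ [b]) (truant m a) \<rbrakk> \<Longrightarrow> esc_node m (a @ [b])"

definition esc_leaf :: "nat \<Rightarrow> nat list \<Rightarrow> bool" where
  "esc_leaf m a \<longleftrightarrow> esc_node m a \<and> universal m a"

definition leaf_ranks :: "nat \<Rightarrow> nat set" where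
  "leaf_ranks m = {length a | a. esc_leaf m a}"

definition R_max :: "nat \<Rightarrow> nat" where
  "R_max m = Max (leaf_ranks m)"

end

theory Submission
  imports Defs "HOL-Library.Multiset"
begin

text \<open>
  Put h = m - 2 and t(x) = x (x - 1) / 2, so that P_m(x) = h t(x) + x and a value of a form is h A + B
  with A = \<Sum> a_i t(x_i) and B = \<Sum> a_i x_i. Taking all x_i in {0, 1} (the case A = 0) shows that an
  escalator node represents everything up to the sum S of its coefficients, hence S < C h for a
  non-universal node. If such a node has rank about h, then the average coefficient is at most C,
  so some c \<le> C is repeated often; let c be the least such value. Letting copies of c take the
  values -1 and 2 shifts A by multiples of c and keeps the range of B an interval of length at
  least S, where S is close to c h. A gap can only remain if no A strictly between 0 and c gives all
  residues of B modulo c, and a finite search over the coefficients below c leaves just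
  c = 3 with [1, 1] or [1, 2] below it. For these two families, t(x) mod 3 depends only on x mod 3,
  which blocks one residue class of N modulo 3 exactly when h is not divisible by 3, respectively
  is divisible by 3; then all N of this class below 3 h - 3 have to be reached with A = 0, which
  determines the rank. The nodes [1, 1, 3, 3, ...] and [1, 2, 3, 3, ...] attain it.
\<close>

subsection \<open>Values of a form as pairs\<close>

\<comment> \<open>Keeps the parameter m = h + 2 from being rewritten to Suc (Suc h).\<close>
declare add_2_eq_Suc' [simp del]

definition tri :: "int \<Rightarrow> int" where
  "tri x = x * (x - 1) div 2"

lemma two_tri: "2 * tri x = x * (x - 1)"
proof -
  have "even (x * (x - 1))" by auto
  thus ?thesis by (simp add: tri_def)
qed

lemma polyg_eq: "polyg (h + 2) x = int h * tri x + x"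
proof -
  have "(int (h + 2) - 2) * x^2 - (int (h + 2) - 4) * x = 2 * (int h * tri x + x)"
    using arg_cong[OF two_tri[of x], of "\<lambda>t. int h * t"]
    by (simp add: algebra_simps power2_eq_square)
  thus ?thesis unfolding polyg_def by simp
qed

text \<open>Both bounds come from a product of two consecutive integers being nonnegative.\<close>

lemma tri_ge: "tri x \<ge> x - 1" "tri x \<ge> - x"
proof -
  have "(x - 1) * (x - 2) \<ge> 0" by (cases "x \<ge> 2") (auto simp: zero_le_mult_iff)
  thus "tri x \<ge> x - 1" using two_tri[of x] by (simp add: algebra_simps)
  have "x * (x + 1) \<ge> 0" by (cases "x \<ge> 0") (auto simp: zero_le_mult_iff)
  thus "tri x \<ge> - x" using two_tri[of x] by (simp add: algebra_simps)
qed

lemma tri_nonneg: "tri x \<ge> 0"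
  using tri_ge[of x] by (cases "x \<ge> 1") auto

lemma tri_zeroD: "tri x = 0 \<Longrightarrow> x = 0 \<or> x = 1"
  using two_tri[of x] by auto

lemma tri_simps [simp]:
  "tri 0 = 0" "tri 1 = 0" "tri (-1) = 1" "tri 2 = 1" "tri (-2) = 3" "tri 3 = 3"
  "tri (-3) = 6" "tri 4 = 6"
  by (simp_all add: tri_def)

text \<open>Source of the obstruction modulo 3: for x = 3k + s the number 2 \<open>tri x\<close> is
  divisible by 3 if s is 0 or 1 and leaves remainder 2 if s = 2, and 2 is invertible modulo
  3.\<close>

lemma tri_mod_3: "tri x mod 3 = (if x mod 3 = 2 then 1 else 0)"
proof -
  define k where "k = x div 3"
  have "x mod 3 = 0 \<or> x mod 3 = 1 \<or> x mod 3 = 2" by presburger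
  moreover have x: "x = 3 * k + x mod 3" by (simp add: k_def)
  ultimately consider "x mod 3 = 0" "2 * tri x = 3 * (k * (3 * k - 1))"
    | "x mod 3 = 1" "2 * tri x = 3 * (k * (3 * k + 1))"
    | "x mod 3 = 2" "2 * tri x = 3 * (k * (3 * k + 3)) + 2"
    unfolding two_tri by (elim disjE) (auto simp: algebra_simps)
  thus ?thesis by cases presburger+
qed

text \<open>Pairs of coefficient and argument are kept in a multiset, so that any coefficient can be
  split off and a subform is a submultiset.\<close>

definition reach :: "nat multiset \<Rightarrow> int \<Rightarrow> int \<Rightarrow> bool" where
  "reach M A B \<longleftrightarrow> (\<exists>P. image_mset fst P = M \<and> (\<Sum>(c, x)\<in>#P. int c * tri x) = A
     \<and> (\<Sum>(c, x)\<in>#P. int c * x) = B)"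

lemma reach_empty [simp]: "reach {#} A B \<longleftrightarrow> A = 0 \<and> B = 0"
  by (auto simp: reach_def)

lemma reach_add_iff:
  "reach (add_mset c M) A B \<longleftrightarrow> (\<exists>x. reach M (A - int c * tri x) (B - int c * x))"
proof
  assume "reach (add_mset c M) A B"
  then obtain P where P: "image_mset fst P = add_mset c M" "(\<Sum>(c, x)\<in>#P. int c * tri x) = A"
    "(\<Sum>(c, x)\<in>#P. int c * x) = B" by (auto simp: reach_def)
  from msed_map_invR[OF P(1)] obtain Q y where Q: "P = add_mset y Q" "fst y = c"
    "image_mset fst Q = M" by auto
  obtain x where y: "y = (c, x)" using Q(2) by (cases y) auto
  show "\<exists>x. reach M (A - int c * tri x) (B - int c * x)"
    unfolding reach_def using P Q y by (intro exI[of _ x] exI[of _ Q]) auto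
next
  assume "\<exists>x. reach M (A - int c * tri x) (B - int c * x)"
  then obtain x P where "image_mset fst P = M" "(\<Sum>(c, x)\<in>#P. int c * tri x) = A - int c * tri x"
    "(\<Sum>(c, x)\<in>#P. int c * x) = B - int c * x" by (auto simp: reach_def)
  thus "reach (add_mset c M) A B" unfolding reach_def
    by (intro exI[of _ "add_mset (c, x) P"]) auto
qed

lemma reach_add: "reach M A B \<Longrightarrow> reach (add_mset c M) (A + int c * tri x) (B + int c * x)"
  by (auto simp: reach_add_iff intro!: exI[of _ x])

lemma reach_mono: "reach M A B \<Longrightarrow> M \<subseteq># M' \<Longrightarrow> reach M' A B"
proof -
  have "reach M A B \<Longrightarrow> reach (M + D) A B" for D
    by (induction D) (use reach_add[where x = 0] in auto)
  thus "reach M A B \<Longrightarrow> M \<subseteq># M' \<Longrightarrow> reach M' A B"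
    by (metis subset_mset.add_diff_inverse)
qed

text \<open>Termwise, \<open>c * tri x\<close> and \<open>c * tri x + c * x\<close> are nonnegative;
  if A = 0, every term has c = 0 or x in {0, 1}, so B is a subsum of the coefficients.\<close>

lemma reach_bounds:
  assumes "reach M A B"
  shows "A \<ge> 0 \<and> B \<ge> - A \<and> (A = 0 \<longrightarrow> 0 \<le> B \<and> B \<le> int (sum_mset M))"
  using assms
proof (induction M arbitrary: A B)
  case (add c M)
  then obtain x where r: "reach M (A - int c * tri x) (B - int c * x)"
    by (auto simp: reach_add_iff)
  note IH = add.IH[OF r]
  have t: "int c * tri x \<ge> 0" "int c * tri x \<ge> - (int c * x)"
    using tri_nonneg[of x] mult_left_mono[OF tri_ge(2)[of x], of "int c"] by auto
  show ?case
  proof (intro conjI impI)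
    assume "A = 0"
    hence z: "int c * tri x = 0" using IH t(1) by linarith
    hence "c = 0 \<or> x = 0 \<or> x = 1" using tri_zeroD by auto
    hence "0 \<le> int c * x \<and> int c * x \<le> int c" by auto
    with IH z \<open>A = 0\<close> show "0 \<le> B" "B \<le> int (sum_mset (add_mset c M))" by auto
  qed (use IH t in linarith)+
qed auto

lemma represents_Nil [simp]: "represents m [] N \<longleftrightarrow> N = 0"
  by (auto simp: represents_def form_val_def)

lemma form_val_Cons: "form_val m (c # a) (x # xs) = int c * polyg m x + form_val m a xs"
  unfolding form_val_def by (simp add: sum.lessThan_Suc_shift del: sum.lessThan_Suc)

text \<open>\<open>N\<close> is an integer because the induction subtracts one term, which may
  exceed \<open>N\<close>.\<close>

lemma form_val_iff_reach:
  "(\<exists>xs. length xs = length a \<and> form_val (h + 2) a xs = N) \<longleftrightarrow>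
   (\<exists>A B. reach (mset a) A B \<and> int h * A + B = N)"
proof (induction a arbitrary: N)
  case (Cons c a)
  have "(\<exists>xs. length xs = length (c # a) \<and> form_val (h + 2) (c # a) xs = N) \<longleftrightarrow>
    (\<exists>x xs. length xs = length a \<and> form_val (h + 2) (c # a) (x # xs) = N)"
    by (auto simp: length_Suc_conv)
  also have "\<dots> \<longleftrightarrow> (\<exists>x. \<exists>xs. length xs = length a \<and>
      form_val (h + 2) a xs = N - int c * polyg (h + 2) x)"
    by (simp add: form_val_Cons eq_diff_eq add.commute)
  also have "\<dots> \<longleftrightarrow> (\<exists>x A B. reach (mset a) A B \<and> int h * A + B = N - int c * polyg (h + 2) x)"
    using Cons.IH by simp
  also have "\<dots> \<longleftrightarrow> (\<exists>A B. reach (mset (c # a)) A B \<and> int h * A + B = N)"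
  proof safe
    fix x A B assume r: "reach (mset a) A B" "int h * A + B = N - int c * polyg (h + 2) x"
    show "\<exists>A B. reach (mset (c # a)) A B \<and> int h * A + B = N"
      using reach_add[OF r(1), of c x] r(2)
      by (intro exI[where x = "A + int c * tri x"] exI[where x = "B + int c * x"])
        (auto simp: polyg_eq algebra_simps)
  next
    fix A B assume r: "reach (mset (c # a)) A B" "N = int h * A + B"
    then obtain x where x: "reach (mset a) (A - int c * tri x) (B - int c * x)"
      by (auto simp: reach_add_iff)
    show "\<exists>x A' B'. reach (mset a) A' B' \<and>
        int h * A' + B' = int h * A + B - int c * polyg (h + 2) x"
      using x by (intro exI[of _ x] exI[of _ "A - int c * tri x"] exI[of _ "B - int c * x"])
        (auto simp: polyg_eq algebra_simps)
  qed
  finally show ?case .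
qed (auto simp: form_val_def)

lemma represents_iff_reach:
  "represents (h + 2) a N \<longleftrightarrow> (\<exists>A B. reach (mset a) A B \<and> int h * A + B = int N)"
  unfolding represents_def by (rule form_val_iff_reach)

lemma represents_mono:
  "represents (h + 2) a N \<Longrightarrow> mset a \<subseteq># mset b \<Longrightarrow> represents (h + 2) b N"
  unfolding represents_iff_reach using reach_mono by blast

lemma universal_mono:
  "universal (h + 2) a \<Longrightarrow> mset a \<subseteq># mset b \<Longrightarrow> universal (h + 2) b"
  unfolding universal_def using represents_mono by blast

lemma represents_0 [simp]: "represents (h + 2) a 0"
  using represents_mono[of h "[]" 0 a] by simp

section \<open>Intervals of values B at a fixed A\<close>

definition reach_int :: "int \<Rightarrow> nat multiset \<Rightarrow> int \<Rightarrow> nat \<Rightarrow> bool" where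
  "reach_int A M u l \<longleftrightarrow> (\<forall>B. u \<le> B \<and> B \<le> u + int l \<longrightarrow> reach M A B)"

lemma reach_intD: "reach_int A M u l \<Longrightarrow> u \<le> B \<Longrightarrow> B \<le> u + int l \<Longrightarrow> reach M A B"
  by (auto simp: reach_int_def)

lemma reach_int_empty: "reach_int 0 {#} 0 0"
  by (auto simp: reach_int_def)

lemma reach_int_mono: "reach_int A M u l \<Longrightarrow> l' \<le> l \<Longrightarrow> reach_int A M u l'"
  by (auto simp: reach_int_def)

text \<open>The values 0 and 1 of the new variable give the old interval of l + 1 integers and its
  shift by \<open>b\<close>, which leave no hole as long as \<open>b <= l + 1\<close>.\<close>

lemma reach_int_add:
  assumes "reach_int A M u l" "b \<le> l + 1"
  shows "reach_int A (add_mset b M) u (l + b)"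
  unfolding reach_int_def
proof safe
  fix B assume B: "u \<le> B" "B \<le> u + int (l + b)"
  show "reach (add_mset b M) A B"
  proof (cases "B \<le> u + int l")
    case True
    thus ?thesis using reach_add[of M A B b 0] reach_intD[OF assms(1)] B by auto
  next
    case False
    hence "reach M A (B - int b)" using assms B by (intro reach_intD[OF assms(1)]) auto
    from reach_add[OF this, of b 1] show ?thesis by simp
  qed
qed

text \<open>The arguments -1 and 2 both have \<open>tri\<close> equal to 1, so A grows by
  \<open>c\<close>; the interval is shifted by -c and by 2c, and these shifts join when
  \<open>3 * c <= l + 1\<close>.\<close>

lemma reach_int_turn:
  assumes "reach_int A M u l" "3 * c \<le> l + 1"
  shows "reach_int (A + int c) (add_mset c M) (u - int c) (l + 3 * c)"
  unfolding reach_int_def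
proof safe
  fix B assume B: "u - int c \<le> B" "B \<le> u - int c + int (l + 3 * c)"
  show "reach (add_mset c M) (A + int c) B"
  proof (cases "B + int c \<le> u + int l")
    case True
    hence "reach M A (B + int c)" using B by (intro reach_intD[OF assms(1)]) auto
    from reach_add[OF this, of c "-1"] show ?thesis by simp
  next
    case False
    hence "reach M A (B - 2 * int c)" using assms B by (intro reach_intD[OF assms(1)]) auto
    from reach_add[OF this, of c 2] show ?thesis by (simp add: algebra_simps)
  qed
qed

lemma reach_int_turns:
  assumes "reach_int A M u l" "3 * c \<le> l + 1"
  shows "reach_int (A + int (c * q)) (M + replicate_mset q c) (u - int (c * q)) (l + 3 * c * q)"
proof (induction q)
  case (Suc q)
  have "3 * c \<le> l + 3 * c * q + 1" using assms(2) by linarith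
  from reach_int_turn[OF Suc this] show ?case by (simp add: algebra_simps)
qed (use assms in simp)

text \<open>
  Each new coefficient is at most one more than the current interval length, so that values in
  {0, 1} extend an interval of values B without gaps.
\<close>

fun ext_ok :: "nat \<Rightarrow> nat list \<Rightarrow> bool" where
  "ext_ok l [] \<longleftrightarrow> True"
| "ext_ok l (b # bs) \<longleftrightarrow> b \<le> l + 1 \<and> ext_ok (l + b) bs"

lemma ext_ok_mono: "ext_ok l bs \<Longrightarrow> l \<le> l' \<Longrightarrow> ext_ok l' bs"
  by (induction bs arbitrary: l l') auto

lemma ext_ok_append: "ext_ok l (xs @ ys) \<longleftrightarrow> ext_ok l xs \<and> ext_ok (l + sum_list xs) ys"
  by (induction xs arbitrary: l) (auto simp: add.assoc)

lemma ext_ok_bounded: "\<forall>b\<in>set bs. b \<le> l + 1 \<Longrightarrow> ext_ok l bs"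
proof (induction bs arbitrary: l)
  case (Cons b bs)
  thus ?case using ext_ok_mono[of l bs "l + b"] by auto
qed auto

lemma reach_int_ext:
  assumes "reach_int A M u l" "ext_ok l bs"
  shows "reach_int A (M + mset bs) u (l + sum_list bs)"
  using assms
proof (induction bs arbitrary: M l)
  case (Cons b bs)
  from Cons.IH[OF reach_int_add[OF Cons.prems(1), of b]] Cons.prems show ?case
    by (simp add: add.assoc)
qed auto

subsection \<open>Escalator nodes\<close>

lemma represents_le_sum:
  assumes "ext_ok 0 a" "N \<le> sum_list a"
  shows "represents (h + 2) a N"
proof -
  have "reach_int 0 (mset a) 0 (sum_list a)"
    using reach_int_ext[OF reach_int_empty assms(1)] by simp
  hence "reach (mset a) 0 (int N)" by (rule reach_intD) (use assms(2) in auto)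
  thus ?thesis unfolding represents_iff_reach by (intro exI) auto
qed

lemma represents_snoc:
  assumes "represents (h + 2) a N"
  shows "represents (h + 2) (a @ [b]) (N + b)"
proof -
  obtain A B where AB: "reach (mset a) A B" "int h * A + B = int N"
    using assms unfolding represents_iff_reach by blast
  from reach_add[OF AB(1), of b 1] AB(2) show ?thesis
    unfolding represents_iff_reach
    by (intro exI[where x = A] exI[where x = "B + int b"]) auto
qed

text \<open>The new variable must be nonzero, and then h t(x) + x >= 2 t(x) + x = x^2 >= 1; the
  other terms contribute a nonnegative amount.\<close>

lemma represents_snoc_le:
  assumes "h \<ge> 2" "represents (h + 2) (a @ [b]) N" "\<not> represents (h + 2) a N"
  shows "b \<le> N"
proof -
  obtain A B where AB: "reach (mset (a @ [b])) A B" "int h * A + B = int N"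
    using assms(2) unfolding represents_iff_reach by blast
  then obtain x where x: "reach (mset a) (A - int b * tri x) (B - int b * x)"
    by (auto simp: reach_add_iff)
  have "x \<noteq> 0" using x AB assms(3) unfolding represents_iff_reach by fastforce
  have "int h * tri x \<ge> 2 * tri x" using assms(1) tri_nonneg by (intro mult_right_mono) auto
  moreover have "x * x \<ge> 1" using \<open>x \<noteq> 0\<close> by (metis mult_eq_0_iff not_one_le_zero one_le_numeral
    zero_le_square linorder_not_le order_antisym_conv zle_add1_eq_le add_0)
  ultimately have "int h * tri x + x \<ge> 1" using two_tri[of x] by (simp add: algebra_simps)
  hence p: "int b * (int h * tri x + x) \<ge> int b * 1" by (intro mult_left_mono) auto
  define A' B' where AB': "A' = A - int b * tri x" "B' = B - int b * x"
  have "A' \<ge> 0" "B' \<ge> - A'" using reach_bounds[OF x] by (auto simp: AB')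
  moreover have "int h * A' \<ge> 1 * A'" using \<open>A' \<ge> 0\<close> assms(1) by (intro mult_right_mono) auto
  ultimately have "int h * A' + B' \<ge> 0" by linarith
  with p AB(2) show ?thesis by (simp add: AB' algebra_simps)
qed

text \<open>By \<open>reach_bounds\<close>, A = 0 yields at most the sum, and A >= 1 yields at least
  (h - 1) A >= h - 1 > N.\<close>

lemma not_represents_small:
  assumes "sum_list a < N" "N + 1 < h"
  shows "\<not> represents (h + 2) a N"
proof
  assume "represents (h + 2) a N"
  then obtain A B where AB: "reach (mset a) A B" "int h * A + B = int N"
    unfolding represents_iff_reach by blast
  note b = reach_bounds[OF AB(1)]
  have "A \<noteq> 0" using b AB assms by (auto simp: sum_mset_sum_list)
  hence "A \<ge> 1" using b by linarith
  hence "(int h - 1) * A \<ge> int h - 1"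
    using assms mult_left_mono[of 1 A "int h - 1"] by simp
  thus False using AB(2) b assms by (simp add: algebra_simps)
qed

lemma truant_props:
  assumes "\<not> universal m a"
  shows "1 \<le> truant m a" "\<not> represents m a (truant m a)"
    and "\<And>N. 1 \<le> N \<Longrightarrow> N < truant m a \<Longrightarrow> represents m a N"
proof -
  have ex: "\<exists>N. 1 \<le> N \<and> \<not> represents m a N" using assms by (auto simp: universal_def)
  from LeastI_ex[OF ex] show "1 \<le> truant m a" "\<not> represents m a (truant m a)"
    by (auto simp: truant_def)
  show "represents m a N" if "1 \<le> N" "N < truant m a" for N
    using not_less_Least[of N "\<lambda>N. 1 \<le> N \<and> \<not> represents m a N"] that
    by (auto simp: truant_def)
qed

lemma truant_le: "1 \<le> N \<Longrightarrow> \<not> represents m a N \<Longrightarrow> truant m a \<le> N"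
  unfolding truant_def by (rule Least_le) auto

lemma esc_node_is_form: "esc_node m a \<Longrightarrow> is_form a"
proof (induction rule: esc_node.induct)
  case (child a b)
  have "x \<le> b" if "x \<in> set a" for x
  proof -
    have "a \<noteq> []" using that by auto
    then obtain a' y where y: "a = a' @ [y]" by (metis rev_exhaust)
    show ?thesis using that child y by (auto simp: is_form_def sorted_append)
  qed
  thus ?case using child by (auto simp: is_form_def sorted_append)
qed (auto simp: is_form_def)

text \<open>Below the parent's truant the parent suffices. From there on, N - b is nonnegative and
  at most the parent's sum, so x = 1 at \<open>b\<close> finishes.\<close>

lemma esc_node_represents_le_sum:
  assumes "h \<ge> 2" "esc_node (h + 2) a" "N \<le> sum_list a"
  shows "represents (h + 2) a N"
  using assms(2,3)
proof (induction a arbitrary: N rule: esc_node.induct)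
  case (child a b)
  let ?T = "truant (h + 2) a"
  note T = truant_props[OF child.hyps(2)]
  have "b \<le> ?T" using represents_snoc_le[OF assms(1) child.hyps(5) T(2)] .
  show ?case
  proof (cases "N < ?T")
    case True
    thus ?thesis using T(3)[of N] represents_mono[of h a N "a @ [b]"] by (cases "N = 0") auto
  next
    case False
    hence "represents (h + 2) a (N - b)" using child by auto
    thus ?thesis using represents_snoc[of h a "N - b" b] False \<open>b \<le> ?T\<close> by simp
  qed
qed simp

text \<open>Prefixes of a node are its ancestors, and each next coefficient is bounded by the truant
  it was added for.\<close>

lemma esc_node_take:
  assumes "h \<ge> 2" "esc_node (h + 2) a" "i < length a"
  shows "esc_node (h + 2) (take i a) \<and> \<not> universal (h + 2) (take i a) \<and>
    a ! i \<le> truant (h + 2) (take i a)"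
  using assms(2,3)
proof (induction a rule: esc_node.induct)
  case (child a b)
  show ?case
  proof (cases "i = length a")
    case True
    thus ?thesis using child truant_props(2)[OF child.hyps(2)]
        represents_snoc_le[OF assms(1) child.hyps(5)] by auto
  next
    case False
    thus ?thesis using child by (auto simp: nth_append)
  qed
qed simp

lemma esc_node_snoc:
  assumes "esc_node (h + 2) a" "\<not> universal (h + 2) a" "1 \<le> b" "a = [] \<or> last a \<le> b"
    and "b \<le> truant (h + 2) a"
  shows "esc_node (h + 2) (a @ [b])"
proof (rule esc_node.child[OF assms(1-4)])
  let ?T = "truant (h + 2) a"
  have "represents (h + 2) a (?T - b)"
    using truant_props(3)[OF assms(2), of "?T - b"] assms(3,5) by (cases "?T - b = 0") auto
  from represents_snoc[OF this, of b] assms(5) show "represents (h + 2) (a @ [b]) ?T" by simp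
qed

text \<open>Used to construct nodes: everything up to the sum is represented, so the truant exceeds
  the sum and every \<open>b <= sum_list a + 1\<close> that keeps the list sorted gives a
  child.\<close>

lemma esc_node_ext_ok:
  assumes "is_form a" "ext_ok 0 a" "\<And>i. i < length a \<Longrightarrow> \<not> universal (h + 2) (take i a)"
  shows "esc_node (h + 2) a"
  using assms
proof (induction a rule: rev_induct)
  case (snoc b a)
  have "esc_node (h + 2) a"
    using snoc.prems(3) by (intro snoc.IH) (use snoc.prems in \<open>force simp: is_form_def sorted_append ext_ok_append\<close>)+
  moreover have nu: "\<not> universal (h + 2) a" using snoc.prems(3)[of "length a"] by simp
  moreover have "b \<le> truant (h + 2) a"
  proof (rule ccontr)
    assume "\<not> ?thesis"
    hence "truant (h + 2) a \<le> sum_list a" using snoc.prems(2) by (auto simp: ext_ok_append)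
    thus False using represents_le_sum[of a "truant (h + 2) a" h] truant_props(2)[OF nu]
        snoc.prems(2) by (auto simp: ext_ok_append)
  qed
  moreover have "a = [] \<or> last a \<le> b" "1 \<le> b"
    using snoc.prems(1) by (cases a rule: rev_cases; auto simp: is_form_def sorted_append)+
  ultimately show ?case by (intro esc_node_snoc)
qed (auto intro: esc_node.root)

subsection \<open>Turning the coefficients below a repeated one\<close>

text \<open>A search over -3 <= x <= 4: each triple is a value t with the two arguments at which
  \<open>tri\<close> equals t. By \<open>reach_list_sound\<close> it yields a certified part of the
  reachable B.\<close>

primrec reach_list :: "nat list \<Rightarrow> int \<Rightarrow> int list" where
  "reach_list [] = (\<lambda>A. if A = 0 then [0] else [])"
| "reach_list (c # cs) = (\<lambda>A. remdups (concat (map (\<lambda>(t, x, y).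
     if int c * t \<le> A then let L = reach_list cs (A - int c * t) in
       map (\<lambda>B. B + int c * x) L @ map (\<lambda>B. B + int c * y) L
     else []) [(0, 0, 1), (1, -1, 2), (3, -2, 3), (6, -3, 4)])))"

lemma reach_list_sound: "B \<in> set (reach_list cs A) \<Longrightarrow> reach (mset cs) A B"
proof (induction cs arbitrary: A B)
  case Nil
  thus ?case by (auto split: if_splits)
next
  case (Cons c cs)
  define F where "F = (\<lambda>(t, x, y). if int c * t \<le> A then let L = reach_list cs (A - int c * t) in
      map (\<lambda>B. B + int c * x) L @ map (\<lambda>B. B + int c * y) L else [])"
  have "B \<in> (\<Union>z\<in>{(0, 0, 1), (1, -1, 2), (3, -2, 3), (6, -3, 4)}. set (F z))"
    using Cons.prems by (simp add: F_def)
  then obtain t x y where txy: "(t, x, y) \<in> {(0, 0, 1), (1, -1, 2), (3, -2, 3), (6, -3, 4)}"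
    and "B \<in> set (F (t, x, y))" by blast
  hence B: "B \<in> (\<lambda>B. B + int c * x) ` set (reach_list cs (A - int c * t)) \<union>
        (\<lambda>B. B + int c * y) ` set (reach_list cs (A - int c * t))"
    by (auto simp: F_def Let_def split: if_splits)
  have "tri x = t" "tri y = t" using txy by auto
  then obtain B' z where "B' \<in> set (reach_list cs (A - int c * t))" "tri z = t" "B = B' + int c * z"
    using B by auto
  thus ?case using reach_add[OF Cons.IH, of B' "A - int c * t" c z] by simp
qed

lemma reach_int_compute:
  assumes "list_all (\<lambda>B. B \<in> set (reach_list cs A)) [u..u + int l]"
  shows "reach_int A (mset cs) u l"
  using assms reach_list_sound unfolding reach_int_def list_all_iff by auto

text \<open>
  Some A strictly between 0 and c admits an interval of values B that misses at most 10 of the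
  values available at A = 0. For \<open>lossless_at\<close> nothing is missed, so that arbitrary further
  coefficients of a node can be appended.
\<close>

definition turnable :: "nat list \<Rightarrow> nat \<Rightarrow> bool" where
  "turnable sm c \<longleftrightarrow> (\<exists>A u l. 1 \<le> A \<and> A < c \<and> -10 \<le> u \<and> u \<le> 10 \<and>
     reach_int (int A) (mset sm + replicate_mset 3 c) u l \<and>
     sum_list sm + 3 * c \<le> l + 10 \<and> 3 * c \<le> l + 1)"

definition lossless_at :: "nat \<Rightarrow> nat list \<Rightarrow> bool" where
  "lossless_at A p \<longleftrightarrow> (\<exists>u. -10 \<le> u \<and> u \<le> 10 \<and> reach_int (int A) (mset p) u (sum_list p))"

lemma turnable_compute:
  assumes "1 \<le> A \<and> A < c \<and> -10 \<le> u \<and> u \<le> 10 \<and> sum_list sm + 3 * c \<le> l + 10 \<and> 3 * c \<le> l + 1"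
    and "list_all (\<lambda>B. B \<in> set (reach_list (sm @ [c, c, c]) (int A))) [u..u + int l]"
  shows "turnable sm c"
proof -
  have "mset (sm @ [c, c, c]) = mset sm + replicate_mset 3 c" by (simp add: numeral_3_eq_3)
  with reach_int_compute[OF assms(2)]
  have "reach_int (int A) (mset sm + replicate_mset 3 c) u l" by (simp only:)
  thus ?thesis using assms(1) unfolding turnable_def by blast
qed

text \<open>The loss of at most 10 is unchanged, since the sum and the interval length both grow by
  \<open>sum_list bs\<close>.\<close>

lemma turnable_append:
  assumes "turnable sm c" "\<forall>b\<in>set bs. b < c"
  shows "turnable (sm @ bs) c"
proof -
  obtain A u l where *: "1 \<le> A" "A < c" "-10 \<le> u" "u \<le> 10"
     "reach_int (int A) (mset sm + replicate_mset 3 c) u l"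
     "sum_list sm + 3 * c \<le> l + 10" "3 * c \<le> l + 1"
    using assms(1) unfolding turnable_def by blast
  have "ext_ok l bs" using assms(2) *(7) by (intro ext_ok_bounded) fastforce
  from reach_int_ext[OF *(5) this]
  have "reach_int (int A) (mset (sm @ bs) + replicate_mset 3 c) u (l + sum_list bs)"
    by (simp add: add_ac)
  thus ?thesis unfolding turnable_def using *
    by (intro exI[of _ A] exI[of _ u] exI[of _ "l + sum_list bs"]) auto
qed

text \<open>At full length the interval at A grows under \<open>ext_ok\<close> like the one at 0, so
  a single prefix \<open>p\<close> settles every c > A and all continuations
  \<open>bs\<close>.\<close>

lemma lossless_turnable:
  assumes "lossless_at A p" "1 \<le> A" "A < c" "ext_ok 0 (p @ bs)" "c \<le> sum_list (p @ bs) + 1"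
  shows "turnable (p @ bs) c"
proof -
  obtain u where u: "-10 \<le> u" "u \<le> 10" "reach_int (int A) (mset p) u (sum_list p)"
    using assms(1) unfolding lossless_at_def by blast
  have "ext_ok (sum_list p) (bs @ replicate 3 c)"
    using assms(4,5) by (auto simp: ext_ok_append intro!: ext_ok_bounded)
  from reach_int_ext[OF u(3) this]
  have "reach_int (int A) (mset (p @ bs) + replicate_mset 3 c) u (sum_list (p @ bs) + 3 * c)"
    by (simp add: add_ac sum_list_replicate)
  thus ?thesis unfolding turnable_def using u assms(2,3)
    by (intro exI[of _ A] exI[of _ u] exI[of _ "sum_list (p @ bs) + 3 * c"]) auto
qed

lemma lossless_compute:
  assumes "-10 \<le> u \<and> u \<le> 10"
    and "list_all (\<lambda>B. B \<in> set (reach_list p (int A))) [u..u + int (sum_list p)]"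
  shows "lossless_at A p"
  using assms(1) reach_int_compute[OF assms(2)] unfolding lossless_at_def by blast

text \<open>Prefixes that settle all sufficiently large c at once. The number passed to
  \<open>lossless_compute\<close> is the left end u of the interval, found by search.\<close>

lemma lossless_table:
  "lossless_at 1 [1, 1, 1]"
  "lossless_at 1 [1, 1, 2]"
  "lossless_at 6 [1, 1, 3]"
  "lossless_at 3 [1, 2, 4]"
  "lossless_at 2 [1, 2, 2, 2]"
  "lossless_at 2 [1, 2, 2, 3]"
  "lossless_at 2 [1, 2, 2, 4]"
  "lossless_at 7 [1, 2, 2, 5]"
  "lossless_at 8 [1, 2, 2, 6]"
  "lossless_at 3 [1, 2, 3, 3]"
  "lossless_at 3 [1, 2, 3, 4]"
  "lossless_at 3 [1, 2, 3, 5]"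
  "lossless_at 6 [1, 2, 3, 6]"
  "lossless_at 9 [1, 2, 3, 7]"
  subgoal by (rule lossless_compute[of "-1"], simp, code_simp)
  subgoal by (rule lossless_compute[of "-1"], simp, code_simp)
  subgoal by (rule lossless_compute[of "-5"], simp, code_simp)
  subgoal by (rule lossless_compute[of "0"], simp, code_simp)
  subgoal by (rule lossless_compute[of "-2"], simp, code_simp)
  subgoal by (rule lossless_compute[of "-2"], simp, code_simp)
  subgoal by (rule lossless_compute[of "-2"], simp, code_simp)
  subgoal by (rule lossless_compute[of "-7"], simp, code_simp)
  subgoal by (rule lossless_compute[of "-3"], simp, code_simp)
  subgoal by (rule lossless_compute[of "-3"], simp, code_simp)
  subgoal by (rule lossless_compute[of "-3"], simp, code_simp)
  subgoal by (rule lossless_compute[of "-3"], simp, code_simp)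
  subgoal by (rule lossless_compute[of "-6"], simp, code_simp)
  subgoal by (rule lossless_compute[of "-9"], simp, code_simp)
  done

text \<open>The cases left over: c is too small for an entry of \<open>lossless_table\<close>, or
  the list may end before the prefix there is complete. The numbers passed are A, u and l.\<close>

lemma lossy_table:
  "turnable [1] 2"
  "turnable [1, 1] 2"
  "turnable [1, 1, 3] 4"
  "turnable [1, 1, 3] 5"
  "turnable [1, 1, 3] 6"
  "turnable [1, 2] 4"
  "turnable [1, 2, 2] 3"
  "turnable [1, 2, 2] 5"
  "turnable [1, 2, 2] 6"
  "turnable [1, 2, 2, 5] 7"
  "turnable [1, 2, 2, 6] 7"
  "turnable [1, 2, 2, 6] 8"
  "turnable [1, 2, 3] 5"
  "turnable [1, 2, 3] 6"
  "turnable [1, 2, 3] 7"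
  "turnable [1, 2, 3, 7] 8"
  "turnable [1, 2, 3, 7] 9"
  subgoal by (rule turnable_compute[of 1 _ "1" _ 5], simp, code_simp)
  subgoal by (rule turnable_compute[of 1 _ "-1" _ 10], simp, code_simp)
  subgoal by (rule turnable_compute[of 1 _ "2" _ 13], simp, code_simp)
  subgoal by (rule turnable_compute[of 1 _ "2" _ 16], simp, code_simp)
  subgoal by (rule turnable_compute[of 3 _ "1" _ 21], simp, code_simp)
  subgoal by (rule turnable_compute[of 1 _ "1" _ 13], simp, code_simp)
  subgoal by (rule turnable_compute[of 1 _ "1" _ 12], simp, code_simp)
  subgoal by (rule turnable_compute[of 2 _ "3" _ 14], simp, code_simp)
  subgoal by (rule turnable_compute[of 1 _ "1" _ 21], simp, code_simp)
  subgoal by (rule turnable_compute[of 2 _ "3" _ 25], simp, code_simp)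
  subgoal by (rule turnable_compute[of 1 _ "1" _ 30], simp, code_simp)
  subgoal by (rule turnable_compute[of 1 _ "1" _ 33], simp, code_simp)
  subgoal by (rule turnable_compute[of 2 _ "1" _ 19], simp, code_simp)
  subgoal by (rule turnable_compute[of 3 _ "3" _ 18], simp, code_simp)
  subgoal by (rule turnable_compute[of 3 _ "3" _ 21], simp, code_simp)
  subgoal by (rule turnable_compute[of 1 _ "4" _ 29], simp, code_simp)
  subgoal by (rule turnable_compute[of 1 _ "4" _ 32], simp, code_simp)
  done

text \<open>By \<open>ext_ok\<close> each coefficient is at most one more than the sum before it, so
  every position has few choices, and each branch ends in one of the two tables. The excluded lists
  are those that can be obstructed modulo 3.\<close>

lemma small_coefficients_turnable:
  assumes "sorted sm" "\<forall>x\<in>set sm. 1 \<le> x \<and> x < c" "ext_ok 0 sm" "c \<le> sum_list sm + 1" "2 \<le> c"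
    and special: "\<not> (c = 3 \<and> (sm = [1, 1] \<or> sm = [1, 2]))"
  shows "turnable sm c"
proof -
  have lossless: "turnable sm c" if "lossless_at A p" "sm = p @ bs" "1 \<le> A" "A < c" for A p bs
    using lossless_turnable[OF that(1,3,4)] assms(3,4) that(2) by simp
  have lossy: "turnable sm c" if "turnable p c'" "c = c'" "sm = p @ bs" for p c' bs
    using turnable_append[of p c bs] that assms(2) by simp
  show ?thesis
  proof (cases sm)
    case Nil
    thus ?thesis using assms(4,5) by simp
  next
    case (Cons x s1)
    hence s1: "sm = 1 # s1" using assms(2,3) by (auto simp: le_antisym)
    show ?thesis
    proof (cases s1)
      case Nil
      hence "c = 2" using assms(4,5) s1 by simp
      thus ?thesis using lossy[OF lossy_table(1)] s1 Nil by simp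
    next
      case (Cons y s2)
      hence s2: "sm = 1 # y # s2" using s1 by simp
      have "y < c" "y = 1 \<or> y = 2" using assms(2,3) s2 by auto
      thus ?thesis
      proof (elim disjE)
        assume y: "y = 1"
        show ?thesis
        proof (cases s2)
          case Nil
          hence "c = 2" using assms(4,5) special s2 y by simp
          thus ?thesis using lossy[OF lossy_table(2)] s2 y Nil by simp
        next
          case (Cons z s3)
          hence s3: "sm = 1 # 1 # z # s3" using s2 y by simp
          have "z < c" "z = 1 \<or> z = 2 \<or> z = 3" using assms(2,3) s3 by auto
          then have "z = 1 \<or> z = 2 \<or> z = 3 \<and> c = 4 \<or> z = 3 \<and> c = 5 \<or> z = 3 \<and> c = 6 \<or>
            z = 3 \<and> 7 \<le> c"
            by presburger
          then consider "z = 1" | "z = 2" | "z = 3" "c = 4" | "z = 3" "c = 5"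
            | "z = 3" "c = 6" | "z = 3" "7 \<le> c"
            by blast
          thus ?thesis
          proof cases
            case 1 thus ?thesis using lossless[OF lossless_table(1)] s3 assms(5) by simp
          next
            case 2 thus ?thesis using lossless[OF lossless_table(2)] s3 assms(5) by simp
          next
            case 3 thus ?thesis using lossy[OF lossy_table(3)] s3 by simp
          next
            case 4 thus ?thesis using lossy[OF lossy_table(4)] s3 by simp
          next
            case 5 thus ?thesis using lossy[OF lossy_table(5)] s3 by simp
          next
            case 6 thus ?thesis using lossless[OF lossless_table(3)] s3 by simp
          qed
        qed
      next
        assume y: "y = 2"
        show ?thesis
        proof (cases s2)
          case Nil
          hence "c = 4" using assms(4,5) special s2 y \<open>y < c\<close> by simp
          thus ?thesis using lossy[OF lossy_table(6)] s2 y Nil by simp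
        next
          case (Cons z s3)
          hence s3: "sm = 1 # 2 # z # s3" using s2 y by simp
          have "z < c" "z = 2 \<or> z = 3 \<or> z = 4" using assms(1-3) s3 by auto
          then have "c = 4 \<or> z = 2 \<and> c = 3 \<or> z = 2 \<and> c = 5 \<or> z = 2 \<and> c = 6 \<or> z = 2 \<and> 7 \<le> c \<or>
            z = 3 \<and> c = 5 \<or> z = 3 \<and> c = 6 \<or> z = 3 \<and> c = 7 \<or> z = 3 \<and> 8 \<le> c \<or> z = 4 \<and> 5 \<le> c"
            by presburger
          then consider "c = 4" | "z = 2" "c = 3" | "z = 2" "c = 5" | "z = 2" "c = 6"
            | "z = 2" "7 \<le> c" | "z = 3" "c = 5" | "z = 3" "c = 6" | "z = 3" "c = 7"
            | "z = 3" "8 \<le> c" | "z = 4" "5 \<le> c"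
            by blast
          thus ?thesis
          proof cases
            case 1 thus ?thesis using lossy[OF lossy_table(6)] s3 by simp
          next
            case 2 thus ?thesis using lossy[OF lossy_table(7)] s3 by simp
          next
            case 3 thus ?thesis using lossy[OF lossy_table(8)] s3 by simp
          next
            case 4 thus ?thesis using lossy[OF lossy_table(9)] s3 by simp
          next
            case 5
            \<comment> \<open>[1, 2, 2] alone would allow only c <= 6, so a fourth coefficient
              exists.\<close>
            then obtain w s4 where s4: "sm = 1 # 2 # 2 # w # s4"
              using assms(4) s3 by (cases s3) auto
            have "w < c" "w = 2 \<or> w = 3 \<or> w = 4 \<or> w = 5 \<or> w = 6" using assms(1-3) s4 by auto
            then have "w = 2 \<or> w = 3 \<or> w = 4 \<or> w = 5 \<and> c = 7 \<or> w = 5 \<and> 8 \<le> c \<or> w = 6 \<and> c = 7 \<or>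
              w = 6 \<and> c = 8 \<or> w = 6 \<and> 9 \<le> c" using 5
              by presburger
            then consider "w = 2" | "w = 3" | "w = 4" | "w = 5" "c = 7" | "w = 5" "8 \<le> c"
              | "w = 6" "c = 7" | "w = 6" "c = 8" | "w = 6" "9 \<le> c"
              by blast
            thus ?thesis
            proof cases
              case 1 thus ?thesis using lossless[OF lossless_table(5)] s4 5 by simp
            next
              case 2 thus ?thesis using lossless[OF lossless_table(6)] s4 5 by simp
            next
              case 3 thus ?thesis using lossless[OF lossless_table(7)] s4 5 by simp
            next
              case 4 thus ?thesis using lossy[OF lossy_table(10)] s4 by simp
            next
              case 5 thus ?thesis using lossless[OF lossless_table(8)] s4 by simp
            next
              case 6 thus ?thesis using lossy[OF lossy_table(11)] s4 by simp
            next
              case 7 thus ?thesis using lossy[OF lossy_table(12)] s4 by simp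
            next
              case 8 thus ?thesis using lossless[OF lossless_table(9)] s4 by simp
            qed
          next
            case 6 thus ?thesis using lossy[OF lossy_table(13)] s3 by simp
          next
            case 7 thus ?thesis using lossy[OF lossy_table(14)] s3 by simp
          next
            case 8 thus ?thesis using lossy[OF lossy_table(15)] s3 by simp
          next
            case 9
            \<comment> \<open>[1, 2, 3] alone would allow only c <= 7.\<close>
            then obtain w s4 where s4: "sm = 1 # 2 # 3 # w # s4"
              using assms(4) s3 by (cases s3) auto
            have "w < c" "w = 3 \<or> w = 4 \<or> w = 5 \<or> w = 6 \<or> w = 7" using assms(1-3) s4 by auto
            then have "w = 3 \<or> w = 4 \<or> w = 5 \<or> w = 6 \<or> w = 7 \<and> c = 8 \<or> w = 7 \<and> c = 9 \<or>
              w = 7 \<and> 10 \<le> c" using 9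
              by presburger
            then consider "w = 3" | "w = 4" | "w = 5" | "w = 6" | "w = 7" "c = 8"
              | "w = 7" "c = 9" | "w = 7" "10 \<le> c"
              by blast
            thus ?thesis
            proof cases
              case 1 thus ?thesis using lossless[OF lossless_table(10)] s4 9 by simp
            next
              case 2 thus ?thesis using lossless[OF lossless_table(11)] s4 9 by simp
            next
              case 3 thus ?thesis using lossless[OF lossless_table(12)] s4 9 by simp
            next
              case 4 thus ?thesis using lossless[OF lossless_table(13)] s4 9 by simp
            next
              case 5 thus ?thesis using lossy[OF lossy_table(16)] s4 by simp
            next
              case 6 thus ?thesis using lossy[OF lossy_table(17)] s4 by simp
            next
              case 7 thus ?thesis using lossless[OF lossless_table(14)] s4 by simp
            qed
          next
            case 10 thus ?thesis using lossless[OF lossless_table(4)] s3 by simp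
          qed
        qed
      qed
    qed
  qed
qed

subsection \<open>Covering by a repeated coefficient\<close>

lemma replicate_mset_add: "replicate_mset (m + n) x = replicate_mset m x + replicate_mset n x"
  by (induction m) auto

text \<open>Subtraction is truncated, so each entry counts only towards the excess over c or only
  towards the deficit below c.\<close>

lemma excess_deficit:
  "(\<Sum>x\<leftarrow>a. x - c) + c * length a = sum_list a + (\<Sum>x\<leftarrow>a. c - x)" for c :: nat
  by (induction a) auto

text \<open>Only the values 1, ..., c - 1 contribute, each at most \<open>M\<close> times, and c - x
  summed over them is c (c - 1) / 2.\<close>

lemma deficit_le:
  fixes a :: "nat list"
  assumes "\<forall>x\<in>set a. 1 \<le> x" "\<And>v. v < c \<Longrightarrow> count_list a v \<le> M"
  shows "2 * (\<Sum>x\<leftarrow>a. c - x) \<le> M * (c * (c - 1))"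
proof -
  have gauss: "2 * (\<Sum>x\<in>{1..<c}. c - x) = c * (c - 1)"
  proof (induction c)
    case (Suc c)
    have "(\<Sum>x\<in>{1..<Suc c}. Suc c - x) = (\<Sum>x\<in>{1..<Suc c}. (c - x) + 1)"
      by (intro sum.cong) auto
    also have "\<dots> = (\<Sum>x\<in>{1..<Suc c}. c - x) + c"
      unfolding sum.distrib by simp
    also have "(\<Sum>x\<in>{1..<Suc c}. c - x) = (\<Sum>x\<in>{1..<c}. c - x)"
      by (cases c) simp_all
    finally show ?case using Suc by (cases c) (auto simp: algebra_simps)
  qed simp
  have "(\<Sum>x\<leftarrow>a. c - x) = (\<Sum>x\<in>set a. count_list a x * (c - x))"
    by (rule sum_list_map_eq_sum_count)
  also have "\<dots> = (\<Sum>x\<in>set a \<inter> {1..<c}. count_list a x * (c - x))"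
    by (rule sum.mono_neutral_right) (use assms(1) in auto)
  also have "\<dots> \<le> (\<Sum>x\<in>set a \<inter> {1..<c}. M * (c - x))"
    by (intro sum_mono mult_right_mono) (use assms(2) in auto)
  also have "\<dots> \<le> (\<Sum>x\<in>{1..<c}. M * (c - x))"
    by (intro sum_mono2) auto
  finally have "(\<Sum>x\<leftarrow>a. c - x) \<le> M * (\<Sum>x\<in>{1..<c}. c - x)"
    by (simp add: sum_distrib_left)
  hence "2 * (\<Sum>x\<leftarrow>a. c - x) \<le> M * (2 * (\<Sum>x\<in>{1..<c}. c - x))" by simp
  thus ?thesis unfolding gauss .
qed

lemma sorted_three_way:
  fixes a :: "nat list"
  assumes "sorted a"
  shows "a = filter (\<lambda>x. x < c) a @ replicate (count_list a c) c @ filter (\<lambda>x. c < x) a"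
  using assms
proof (induction a)
  case (Cons x a)
  consider "x < c" | "x = c" | "c < x" by linarith
  thus ?case
  proof cases
    case 1 thus ?thesis using Cons by auto
  next
    case 2
    hence "filter (\<lambda>x. x < c) a = []" using Cons.prems by (auto simp: filter_empty_conv)
    thus ?thesis using Cons 2 by auto
  next
    case 3
    hence "filter (\<lambda>x. x < c) a = []" "count_list a c = 0" "filter (\<lambda>x. c < x) a = a"
      using Cons.prems by (auto simp: filter_empty_conv count_list_0_iff filter_id_conv)
    thus ?thesis using 3 by auto
  qed
qed simp

text \<open>The q copies of c are turned after at least three others have made the interval long
  enough for \<open>reach_int_turn\<close>. A turned copy adds 3c instead of c to the length, whence
  the surplus 2cq.\<close>

lemma reach_int_multiples:
  assumes "ext_ok 0 (sm @ replicate k c @ bg)" "q + 3 \<le> k"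
  shows "reach_int (int (c * q)) (mset (sm @ replicate k c @ bg)) (- int (c * q))
    (sum_list (sm @ replicate k c @ bg) + 2 * c * q)"
proof -
  obtain k1 where k1: "k = k1 + q" "3 \<le> k1"
    using assms(2) by (metis le_add_diff_inverse2 add_le_imp_le_diff add_leE add.commute)
  have "ext_ok (sum_list sm) (replicate (Suc (k - 1)) c)"
    using assms by (simp add: ext_ok_append)
  hence c: "c \<le> sum_list sm + 1" by simp
  have "ext_ok 0 (sm @ replicate k1 c)"
    using assms c by (auto simp: ext_ok_append intro!: ext_ok_bounded)
  from reach_int_ext[OF reach_int_empty this]
  have 1: "reach_int 0 (mset sm + replicate_mset k1 c) 0 (sum_list sm + k1 * c)"
    by (simp add: sum_list_replicate)
  have "3 * c \<le> k1 * c" using k1 by (intro mult_right_mono) auto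
  hence "3 * c \<le> (sum_list sm + k1 * c) + 1" by linarith
  note 2 = reach_int_turns[OF 1 this, of q]
  have "ext_ok (sum_list sm + k * c) bg"
    using assms(1) by (simp add: ext_ok_append sum_list_replicate)
  hence "ext_ok (sum_list sm + k1 * c + 3 * c * q) bg"
    by (rule ext_ok_mono) (auto simp: k1 algebra_simps)
  from reach_int_ext[OF 2 this]
  show ?thesis
    by (simp add: k1 replicate_mset_add sum_list_replicate algebra_simps)
qed

lemma reach_multiples:
  assumes "ext_ok 0 (sm @ replicate k c @ bg)" "q + 3 \<le> k"
    and "- int (c * q) \<le> B" "B \<le> int (sum_list (sm @ replicate k c @ bg))"
  shows "reach (mset (sm @ replicate k c @ bg)) (int (c * q)) B"
proof (rule reach_intD[OF reach_int_multiples[OF assms(1,2)] assms(3)])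
  have "int (sum_list (sm @ replicate k c @ bg) + 2 * c * q) =
      int (sum_list (sm @ replicate k c @ bg)) + 2 * int (c * q)"
    by simp
  moreover have "int (c * q) \<ge> 0" by simp
  ultimately show "B \<le> - int (c * q) + int (sum_list (sm @ replicate k c @ bg) + 2 * c * q)"
    using assms(4) by linarith
qed

text \<open>As in \<open>reach_int_multiples\<close>, but with three copies of c spent on reaching A
  at a loss of e; the bound on \<open>bg\<close> absorbs this loss.\<close>

lemma reach_int_turnable:
  assumes "reach_int A (mset sm + replicate_mset 3 c) u l" "sum_list sm + 3 * c \<le> l + e"
    and "3 * c \<le> l + 1" "q + 3 \<le> k" "\<forall>b\<in>set bg. b + e \<le> sum_list sm + k * c"
  shows "reach_int (A + int (c * q)) (mset (sm @ replicate k c @ bg)) (u - int (c * q))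
    (sum_list (sm @ replicate k c @ bg) - e + 2 * c * q)"
proof -
  obtain k1 where k1: "k = k1 + 3 + q" using assms(4) by (metis le_add_diff_inverse2 add.assoc add.commute)
  note 1 = reach_int_turns[OF assms(1,3), of q]
  have "ext_ok (l + 3 * c * q) (replicate k1 c @ bg)"
    unfolding ext_ok_append
  proof
    show "ext_ok (l + 3 * c * q) (replicate k1 c)"
      using assms(3) by (intro ext_ok_bounded) auto
    show "ext_ok (l + 3 * c * q + sum_list (replicate k1 c)) bg"
      using assms(2,5) by (intro ext_ok_bounded) (force simp: k1 sum_list_replicate algebra_simps)
  qed
  from reach_int_ext[OF 1 this]
  have "reach_int (A + int (c * q)) (mset (sm @ replicate k c @ bg)) (u - int (c * q))
    (l + 3 * c * q + sum_list (replicate k1 c @ bg))"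
    by (simp add: k1 replicate_mset_add numeral_3_eq_3 add_ac)
  thus ?thesis
    by (rule reach_int_mono) (use assms(2) in \<open>simp add: k1 sum_list_replicate algebra_simps\<close>)
qed

lemma represents_reach: "reach (mset a) A B \<Longrightarrow> int h * A + B = int N \<Longrightarrow> represents (h + 2) a N"
  unfolding represents_iff_reach by blast

text \<open>Write N = q (c h) + r. For r up to the sum, A = c q and B = r work, so only remainders
  between the sum and c h are left. The larger list \<open>a'\<close> lets a child fill
  them.\<close>

lemma covering_criterion:
  fixes h K c k :: nat and sm bg :: "nat list"
  defines "a \<equiv> sm @ replicate k c @ bg"
  assumes "ext_ok 0 a" "K + 3 \<le> k" "1 \<le> c" "1 \<le> h"
    and rest: "\<And>q r. q \<le> K \<Longrightarrow> sum_list a < r \<Longrightarrow> r < c * h \<Longrightarrow> c * q * h + r \<le> K * h \<Longrightarrow>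
      represents (h + 2) a' (c * q * h + r)"
    and sub: "mset a \<subseteq># mset a'" and N: "N \<le> K * h"
  shows "represents (h + 2) a' N"
proof -
  define q r where "q = N div (c * h)" and "r = N mod (c * h)"
  have Nqr: "N = c * q * h + r"
    using mult_div_mod_eq[of "c * h" N] by (simp add: q_def r_def ac_simps)
  have r: "r < c * h" using assms(4,5) by (simp add: r_def)
  have "(c * q) * h \<le> K * h" using N Nqr by linarith
  hence "c * q \<le> K" using assms(5) by (auto simp: mult_le_cancel2)
  moreover have "1 * q \<le> c * q" using assms(4) by (intro mult_right_mono) auto
  ultimately have q: "q \<le> K" by linarith
  show ?thesis
  proof (cases "r \<le> sum_list a")
    case True
    have "reach (mset a) (int (c * q)) (int r)"
      unfolding a_def
    proof (rule reach_multiples)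
      show "- int (c * q) \<le> int r" by (rule order_trans[of _ 0]) simp_all
    qed (use assms(2,3) q True in \<open>simp_all add: a_def\<close>)
    hence "represents (h + 2) a N" by (rule represents_reach) (simp add: Nqr algebra_simps)
    thus ?thesis using sub by (rule represents_mono)
  next
    case False
    thus ?thesis using rest[of q r] q r N Nqr by simp
  qed
qed

lemma turnable_covers:
  fixes h K c k :: nat and sm bg :: "nat list"
  defines "a \<equiv> sm @ replicate k c @ bg"
  assumes "ext_ok 0 a" "K + 3 \<le> k" "1 \<le> h" "turnable sm c"
    and big: "\<forall>b\<in>set bg. b + 10 \<le> sum_list sm + k * c"
    and S: "(c - 1) * h + 20 \<le> sum_list a" and N: "N \<le> K * h"
  shows "represents (h + 2) a N"
proof -
  obtain A u l where A: "1 \<le> A" "A < c" "-10 \<le> u" "u \<le> 10"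
    "reach_int (int A) (mset sm + replicate_mset 3 c) u l"
    "sum_list sm + 3 * c \<le> l + 10" "3 * c \<le> l + 1"
    using assms(5) unfolding turnable_def by blast
  have "represents (h + 2) a (c * q * h + r)"
    if q: "q \<le> K" and r: "sum_list a < r" "r < c * h" for q r
  proof (rule represents_reach)
    \<comment> \<open>B = r - A h stays 20 away from both ends of the range from 0 to the sum: 10
      for the offset u and 10 for the loss.\<close>
    have "A * h \<le> (c - 1) * h" "1 * h \<le> A * h" using A by (intro mult_right_mono; simp)+
    moreover have "c * h = (c - 1) * h + h" using A by (cases c) auto
    ultimately have "A * h + 20 \<le> r" "r + 20 \<le> A * h + sum_list a"
      using r S by linarith+
    hence bd: "int A * int h + 20 \<le> int r" "int r + 20 \<le> int A * int h + int (sum_list a)"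
      by (simp_all flip: of_nat_mult)
    have ri: "reach_int (int A + int (c * q)) (mset a) (u - int (c * q))
      (sum_list a - 10 + 2 * c * q)"
      unfolding a_def using A q assms(3) big by (intro reach_int_turnable) auto
    have "int (sum_list a - 10 + 2 * c * q) = int (sum_list a) - 10 + 2 * int (c * q)"
      using S by simp
    moreover have "int (c * q) \<ge> 0" by simp
    ultimately show "reach (mset a) (int A + int (c * q)) (int r - int A * int h)"
      using bd A(3,4) by (intro reach_intD[OF ri]) linarith+
    show "int h * (int A + int (c * q)) + (int r - int A * int h) = int (c * q * h + r)"
      by (simp add: algebra_simps)
  qed
  from covering_criterion[of sm k c bg K h a N, folded a_def, OF assms(2,3) _ assms(4) this _ N]
  show ?thesis using A by auto
qed

subsection \<open>Forms built from threes\<close>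

lemma reach_replicate:
  "reach M A B \<Longrightarrow> reach (M + replicate_mset n c) (A + int (n * c) * tri x) (B + int (n * c) * x)"
proof (induction n)
  case (Suc n)
  from reach_add[OF Suc.IH[OF Suc.prems], of c x] show ?case by (simp add: algebra_simps)
qed simp

lemma reach_dvd:
  assumes "reach M A B" "\<forall>x\<in>#M. p dvd x"
  shows "int p dvd A \<and> int p dvd B"
  using assms
proof (induction M arbitrary: A B)
  case (add c M)
  then obtain x where x: "reach M (A - int c * tri x) (B - int c * x)"
    by (auto simp: reach_add_iff)
  have "int p dvd int c" using add.prems by simp
  hence "int p dvd int c * y" for y by simp
  moreover have "int p dvd A - int c * tri x \<and> int p dvd B - int c * x"
    using add.IH[OF x] add.prems by simp
  ultimately show ?case by (metis diff_add_cancel dvd_add)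
qed auto

text \<open>Giving q threes the value -1 raises A by 3q and lowers B by 3q; q threes with value 1
  compensate B, and j more supply r - A h - v = 3j. The last hypothesis makes these j + 2q threes
  available.\<close>

lemma threes_represent:
  assumes "reach P A v" "P + replicate_mset k 3 \<subseteq># mset a"
    and "3 dvd int r - A * int h - v" "A * int h + v \<le> int r"
    and "int r - A * int h - v + 6 * int q \<le> 3 * int k"
  shows "represents (h + 2) a (3 * q * h + r)"
proof -
  obtain j' where j': "int r - A * int h - v = 3 * j'" using assms(3) by (auto simp: dvd_def)
  define j where "j = nat j'"
  have j: "int r - A * int h - v = 3 * int j" using j' assms(4) by (simp add: j_def)
  have "reach (P + replicate_mset q 3 + replicate_mset (j + q) 3) (A + 3 * int q) (v + 3 * int j)"
    using reach_replicate[OF reach_replicate[OF assms(1), of q 3 "-1"], of "j + q" 3 1]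
    by (simp add: algebra_simps)
  moreover have "P + replicate_mset q 3 + replicate_mset (j + q) 3 \<subseteq># P + replicate_mset k 3"
  proof -
    have "q + (j + q) \<le> k" using assms(5) j by linarith
    then obtain i where "k = q + (j + q) + i" using le_Suc_ex by blast
    thus ?thesis by (simp add: replicate_mset_add add.assoc)
  qed
  ultimately have "reach (mset a) (A + 3 * int q) (v + 3 * int j)"
    using reach_mono assms(2) subset_mset.order_trans by blast
  thus ?thesis by (rule represents_reach) (use j in \<open>simp add: algebra_simps\<close>)
qed

text \<open>The class of N modulo 3 that \<open>[1, d]\<close> followed by multiples of 3 misses
  whenever 3 does not divide A. It exists for d = 1 if 3 does not divide h, and for d = 2 if it
  does.\<close>

definition bad_residue :: "nat \<Rightarrow> nat \<Rightarrow> nat \<Rightarrow> bool" where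
  "bad_residue d h N \<longleftrightarrow> d = 1 \<and> h mod 3 = 1 \<and> N mod 3 = 2 \<or>
     d = 1 \<and> h mod 3 = 2 \<and> N mod 3 = 0 \<or> d = 2 \<and> h mod 3 = 0 \<and> N mod 3 = 0"

text \<open>A = 0 stops at the sum and A >= 3 starts at 3 (h - 1), so A is 1 or 2. Modulo 3, A and B
  depend only on the residues of the first two variables, and no combination hits the class.\<close>

lemma not_represents_bad_residue:
  assumes bad: "bad_residue d h N" and T: "\<forall>x\<in>set T. 3 dvd x"
    and N: "1 + d + sum_list T < N" "N + 3 < 3 * h"
  shows "\<not> represents (h + 2) (1 # d # T) N"
proof
  assume "represents (h + 2) (1 # d # T) N"
  then obtain A B where AB: "reach (mset (1 # d # T)) A B" "int h * A + B = int N"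
    unfolding represents_iff_reach by blast
  note b = reach_bounds[OF AB(1)]
  have "A \<noteq> 0"
  proof
    assume "A = 0"
    hence "int N \<le> int (sum_mset (mset (1 # d # T)))" using b AB(2) by simp
    thus False using N(1) by (simp add: sum_mset_sum_list)
  qed
  have "A < 3"
  proof (rule ccontr)
    assume "\<not> A < 3"
    hence "(int h - 1) * A \<ge> (int h - 1) * 3" using N by (intro mult_left_mono) auto
    moreover have "(int h - 1) * A \<le> int N" using AB(2) b by (simp add: algebra_simps)
    ultimately show False using N(2) by simp
  qed
  hence A: "\<not> 3 dvd A" using \<open>A \<noteq> 0\<close> b by presburger
  obtain x y where xy: "reach (mset T) (A - tri x - int d * tri y) (B - x - int d * y)"
    using AB(1) by (auto simp: reach_add_iff)
  have dvd: "3 dvd A - (tri x + int d * tri y)" "3 dvd B - (x + int d * y)"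
    using reach_dvd[OF xy, of 3] T by (auto simp: diff_diff_eq)
  have lin3: "(u mod 3 + int d * (v mod 3)) mod 3 = (u + int d * v) mod 3" for u v :: int
    by (rule mod_add_cong) (simp_all add: mod_mult_right_eq)
  have A3: "A mod 3 = (tri x mod 3 + int d * (tri y mod 3)) mod 3"
    using dvd(1) by (simp add: mod_eq_dvd_iff[symmetric] lin3)
  have B3: "B mod 3 = (x mod 3 + int d * (y mod 3)) mod 3"
    using dvd(2) by (simp add: mod_eq_dvd_iff[symmetric] lin3)
  have N3: "int N mod 3 = (int h mod 3 * (A mod 3) + B mod 3) mod 3"
    unfolding AB(2)[symmetric] by (rule mod_add_cong) (simp_all add: mod_mult_eq)
  have xy3: "x mod 3 = 0 \<or> x mod 3 = 1 \<or> x mod 3 = 2" "y mod 3 = 0 \<or> y mod 3 = 1 \<or> y mod 3 = 2"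
    by presburger+
  have "A mod 3 \<noteq> 0" using A by presburger
  moreover have "int h mod 3 = int (h mod 3)" "int N mod 3 = int (N mod 3)"
    by (simp_all add: of_nat_mod)
  ultimately show False
    using bad xy3 N3 unfolding bad_residue_def A3 B3 tri_mod_3
    by (elim disjE conjE) simp_all
qed

lemma reach_pair:
  "reach {#1, 1#} 1 (-1)" "reach {#1, 1#} 1 0" "reach {#1, 1#} 2 (-2)"
  "reach {#1, 2#} 1 (-1)" "reach {#1, 2#} 1 1" "reach {#1, 2#} 2 (-2)" "reach {#1, 2#} 2 (-1)"
  using reach_list_sound[of _ "[1, 1]" 1] reach_list_sound[of _ "[1, 1]" 2]
    reach_list_sound[of _ "[1, 2]" 1] reach_list_sound[of _ "[1, 2]" 2] by simp_all

text \<open>Every other class is hit by a pair from \<open>reach_pair\<close> with A = 1 or 2, and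
  threes fill up the difference.\<close>

lemma threes_represent_good_residue:
  assumes d: "d = 1 \<or> d = 2" and good: "\<not> bad_residue d h r"
    and sub: "{#1, d#} + replicate_mset k 3 \<subseteq># mset a"
    and r: "2 * h + 1 \<le> r" "r \<le> 3 * h" "2 * h + 6 * q + 2 \<le> 3 * k"
  shows "represents (h + 2) a (3 * q * h + r)"
proof -
  have *: "represents (h + 2) a (3 * q * h + r)"
    if "reach {#1, d#} A v" "3 dvd int r - A * int h - v" "1 \<le> A" "A \<le> 2" "-2 \<le> v" "v \<le> 1" for A v
  proof (rule threes_represent[OF that(1) sub that(2)])
    have "1 * int h \<le> A * int h" "A * int h \<le> 2 * int h" using that by (intro mult_right_mono; simp)+
    thus "A * int h + v \<le> int r" "int r - A * int h - v + 6 * int q \<le> 3 * int k"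
      using r that by linarith+
  qed
  show ?thesis
  proof (cases "d = 1")
    case True
    have "3 dvd int r - int h + 1 \<or> 3 dvd int r - int h \<or> 3 dvd int r - 2 * int h + 2"
      using good True unfolding bad_residue_def by presburger
    thus ?thesis
      using *[of 1 "-1"] *[of 1 0] *[of 2 "-2"] reach_pair(1-3) True by (elim disjE) simp_all
  next
    case False
    hence d: "d = 2" using d by simp
    have "3 dvd int r - int h + 1 \<or> 3 dvd int r - int h - 1 \<or>
        3 dvd int r - 2 * int h + 2 \<or> 3 dvd int r - 2 * int h + 1"
      using good d unfolding bad_residue_def by presburger
    thus ?thesis
      using *[of 1 "-1"] *[of 1 1] *[of 2 "-2"] *[of 2 "-1"] reach_pair(4-7) d
      by (elim disjE) simp_all
  qed
qed

text \<open>Adding 0 or b to B shifts the residues available at A = 1, which then exhaust all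
  classes: no obstruction survives.\<close>

lemma threes_represent_mixed:
  assumes d: "d = 1 \<or> d = 2" and b: "\<not> 3 dvd b"
    and sub: "{#b, 1, d#} + replicate_mset k 3 \<subseteq># mset a"
    and r: "h + b + 1 \<le> r" "r \<le> 3 * h" "2 * h + 6 * q + 1 \<le> 3 * k"
  shows "represents (h + 2) a (3 * q * h + r)"
proof -
  have *: "represents (h + 2) a (3 * q * h + r)"
    if "reach {#1, d#} 1 v" "x = 0 \<or> x = 1" "3 dvd int r - int h - (v + int b * x)" "-1 \<le> v" "v \<le> 1"
    for v x
  proof (rule threes_represent[OF _ sub])
    show "reach {#b, 1, d#} 1 (v + int b * x)"
      using reach_add[OF that(1), of b x] that(2) by auto
    show "3 dvd int r - 1 * int h - (v + int b * x)" using that(3) by simp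
    have "0 \<le> int b * x" "int b * x \<le> int b" using that(2) by auto
    thus "1 * int h + (v + int b * x) \<le> int r"
      "int r - 1 * int h - (v + int b * x) + 6 * int q \<le> 3 * int k"
      using r that(4,5) by linarith+
  qed
  show ?thesis
  proof (cases "d = 1")
    case True
    have "3 dvd int r - int h + 1 \<or> 3 dvd int r - int h \<or> 3 dvd int r - int h - (int b - 1) \<or>
       3 dvd int r - int h - int b"
      using b by presburger
    thus ?thesis
      using *[of "-1" 0] *[of 0 0] *[of "-1" 1] *[of 0 1] reach_pair(1,2) True
      by (elim disjE) simp_all
  next
    case False
    hence d: "d = 2" using d by simp
    have "3 dvd int r - int h + 1 \<or> 3 dvd int r - int h - 1 \<or> 3 dvd int r - int h - (int b - 1) \<or>
       3 dvd int r - int h - (1 + int b)"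
      using b by presburger
    thus ?thesis
      using *[of "-1" 0] *[of 1 0] *[of "-1" 1] *[of 1 1] reach_pair(4,5) d
      by (elim disjE) simp_all
  qed
qed

lemma pure_threes_gap:
  fixes d h K k :: nat and bg :: "nat list"
  defines "a \<equiv> [1, d] @ replicate k 3 @ bg"
  assumes d: "d = 1 \<or> d = 2" and ext: "ext_ok 0 a" and k: "K + 3 \<le> k" and h: "1 \<le> h"
    and S: "2 * h + 1 \<le> sum_list a" and k3: "2 * h + 6 * K + 2 \<le> 3 * k"
    and N: "N \<le> K * h" "\<not> represents (h + 2) a N"
  shows "\<exists>N0. sum_list a < N0 \<and> N0 \<le> sum_list a + 3 \<and> N0 + 4 \<le> 3 * h \<and> bad_residue d h N0"
proof -
  have "\<exists>q r. q \<le> K \<and> sum_list a < r \<and> r < 3 * h \<and> 3 * q * h + r \<le> K * h \<and>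
      \<not> represents (h + 2) a (3 * q * h + r)"
    using covering_criterion[of "[1, d]" k 3 bg K h a N, folded a_def] ext k h N by auto
  then obtain q r where qr: "q \<le> K" "sum_list a < r" "r < 3 * h" "3 * q * h + r \<le> K * h"
    "\<not> represents (h + 2) a (3 * q * h + r)" by blast
  have bad: "bad_residue d h r"
  proof (rule ccontr)
    assume "\<not> ?thesis"
    hence "represents (h + 2) a (3 * q * h + r)"
      by (rule threes_represent_good_residue[OF d, where k = k])
        (use qr S k3 in \<open>auto simp: a_def\<close>)
    thus False using qr(5) by simp
  qed
  have r: "r + 4 \<le> 3 * h"
  proof (rule ccontr)
    assume "\<not> ?thesis"
    hence r: "3 * h \<le> r + 3" by simp
    \<comment> \<open>Otherwise 3 q h + r with r > 2h would exceed K h. Hence one more copy can be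
      turned: A = 3 (q + 1), B = r - 3h >= -3.\<close>
    have "3 * q + 3 \<le> K"
    proof (rule ccontr)
      assume "\<not> ?thesis"
      hence "K * h \<le> (3 * q + 2) * h" by (intro mult_right_mono) auto
      hence "K * h \<le> 3 * q * h + 2 * h" by (simp add: algebra_simps)
      thus False using qr(2,4) S by linarith
    qed
    hence q: "Suc q + 3 \<le> k" using k by linarith
    have "reach (mset a) (int (3 * Suc q)) (int r - 3 * int h)"
      using ext q r qr(2,3) unfolding a_def
      by (intro reach_multiples) (auto simp del: append_Cons sum_list.append sum_list_replicate)
    hence "represents (h + 2) a (3 * q * h + r)"
      by (rule represents_reach) (simp add: algebra_simps)
    thus False using qr(5) by simp
  qed
  \<comment> \<open>The least number above the sum in the residue class of r.\<close>
  define N0 where "N0 = sum_list a + 1 + (r - sum_list a - 1) mod 3"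
  have N0: "N0 mod 3 = r mod 3" "N0 \<le> r" "sum_list a < N0" "N0 \<le> sum_list a + 3"
  proof -
    obtain e where "r = sum_list a + 1 + e" using qr(2) by (metis Suc_eq_plus1 less_eqE Suc_leI)
    thus "N0 mod 3 = r mod 3" "N0 \<le> r" "sum_list a < N0" "N0 \<le> sum_list a + 3"
      unfolding N0_def using mod_add_right_eq[of "sum_list a + 1" e 3] by auto
  qed
  have "bad_residue d h N0" using bad N0(1) by (simp add: bad_residue_def)
  thus ?thesis using N0 r by (intro exI[of _ N0]) auto
qed

text \<open>
  For a node whose coefficients from the third on are multiples of 3, this is the only way in which
  the next coefficient can exceed the sum by more than 1; it fills all gaps left by the values A
  divisible by 3.
\<close>

lemma exceptional_child_covers:
  fixes h K k b :: nat and sm bg :: "nat list"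
  defines "a \<equiv> sm @ replicate k 3 @ bg"
  assumes ext: "ext_ok 0 a" and k: "K + 3 \<le> k" and h: "1 \<le> h"
    and b: "sum_list a + 2 \<le> b" "b \<le> sum_list a + 3"
    and less: "\<And>N. N < b \<Longrightarrow> represents (h + 2) a N"
    and S: "3 * h \<le> 2 * sum_list a + 2" and N: "N \<le> K * h"
  shows "represents (h + 2) (a @ [b]) N"
proof -
  have "represents (h + 2) (a @ [b]) (3 * q * h + r)"
    if q: "q \<le> K" and r: "sum_list a < r" "r < 3 * h" for q r
  proof (cases "q = 0 \<and> r < b")
    case True
    hence "represents (h + 2) a (3 * q * h + r)" using less by simp
    thus ?thesis by (rule represents_mono) simp
  next
    case False
    \<comment> \<open>B = r - b must be at least -3q: the case split gives r >= b for q = 0, and for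
      q >= 1 the bound b <= \<open>sum_list a\<close> + 3 suffices.\<close>
    have "int (3 * q) + int r \<ge> int b"
    proof (cases "q = 0")
      case False thus ?thesis using b r by linarith
    qed (use False in simp)
    hence "- int (3 * q) \<le> int r - int b" by linarith
    moreover have "int r - int b \<le> int (sum_list a)" using r S b by linarith
    ultimately have "reach (mset a) (int (3 * q)) (int r - int b)"
      unfolding a_def by (intro reach_multiples) (use ext q k in \<open>simp_all add: a_def\<close>)
    from reach_add[OF this, of b 1]
    have "reach (mset (a @ [b])) (int (3 * q)) (int r)" by simp
    thus ?thesis by (rule represents_reach) (simp add: algebra_simps)
  qed
  from covering_criterion[of sm k 3 bg K h "a @ [b]" N, folded a_def, OF ext k _ h this _ N]
  show ?thesis by simp
qed

section \<open>Lengths of non-universal nodes\<close>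

lemma longest_ext_ok_prefix:
  assumes h: "2 \<le> h" and node: "esc_node (h + 2) a" and n: "h \<le> length a + 1"
    and sum: "sum_list a < K * h" and K: "1 \<le> K"
  shows "\<exists>i \<le> length a. ext_ok 0 (take i a) \<and> h \<le> i + 1 + K \<and> h \<le> sum_list (take i a) + 2 \<and>
    (i < length a \<longrightarrow> sum_list (take i a) + 2 \<le> a ! i)"
proof -
  have form: "sorted a" "\<forall>x\<in>set a. 1 \<le> x" using esc_node_is_form[OF node] by (auto simp: is_form_def)
  define P where "P i \<longleftrightarrow> i \<le> length a \<and> ext_ok 0 (take i a)" for i
  have "P 0" "\<forall>i. P i \<longrightarrow> i \<le> length a" by (auto simp: P_def)
  then obtain i where i: "P i" "\<And>j. P j \<Longrightarrow> j \<le> i" by (metis Nat.ex_has_greatest_nat)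
  have jump: "sum_list (take i a) + 2 \<le> a ! i" if "i < length a"
  proof (rule ccontr)
    assume "\<not> ?thesis"
    hence "P (Suc i)" using i(1) that by (auto simp: P_def take_Suc_conv_app_nth ext_ok_append)
    thus False using i(2) by fastforce
  qed
  have "h \<le> sum_list (take i a) + 2 \<and> h \<le> i + 1 + K"
  proof (cases "i < length a")
    case True
    note nt = esc_node_take[OF h node True]
    \<comment> \<open>With a smaller sum, sum + 1 would not be represented, and the truant would be
      too small to admit the jump.\<close>
    have hS: "h \<le> sum_list (take i a) + 2"
    proof (rule ccontr)
      assume "\<not> ?thesis"
      hence "\<not> represents (h + 2) (take i a) (sum_list (take i a) + 1)"
        by (intro not_represents_small) auto
      hence "truant (h + 2) (take i a) \<le> sum_list (take i a) + 1" by (intro truant_le) auto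
      thus False using nt jump[OF True] by linarith
    qed
    \<comment> \<open>From the jump on all coefficients are at least h, so a total below K h has
      room for fewer than K of them.\<close>
    have "h \<le> x" if x: "x \<in> set (drop i a)" for x
    proof -
      obtain j where "j < length (drop i a)" "x = drop i a ! j" using x by (metis in_set_conv_nth)
      hence "a ! i \<le> x" using form(1) by (auto intro!: sorted_nth_mono)
      thus ?thesis using jump[OF True] hS by linarith
    qed
    hence "(\<Sum>x\<leftarrow>drop i a. h) \<le> sum_list (drop i a)"
      using sum_list_mono[of "drop i a" "\<lambda>_. h" "\<lambda>x. x"] by simp
    hence "(length a - i) * h \<le> sum_list (drop i a)" by (simp add: sum_list_triv)
    also have "\<dots> \<le> sum_list a" by (metis append_take_drop_id le_add2 sum_list.append)
    also have "\<dots> < K * h" by (rule sum)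
    finally have "length a - i < K" by simp
    thus ?thesis using hS n by linarith
  next
    case False
    hence "i = length a" using i(1) by (simp add: P_def)
    moreover have "length a \<le> sum_list a"
      using sum_list_mono[of a "\<lambda>_. 1" "\<lambda>x. x"] form(2) by (simp add: sum_list_triv)
    ultimately show ?thesis using n K by simp
  qed
  thus ?thesis using i(1) jump by (auto simp: P_def)
qed

text \<open>The gap contains at most r = h - 1, and q h + h - 1 is reached by A = q + 1, B =
  -1.\<close>

lemma ones_cover:
  fixes h K k :: nat and bg :: "nat list"
  defines "a \<equiv> [] @ replicate k 1 @ bg"
  assumes ext: "ext_ok 0 a" and k: "K + 3 \<le> k" and h: "2 \<le> h"
    and S: "h \<le> sum_list a + 2" and N: "N \<le> K * h"
  shows "represents (h + 2) a N"
proof -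
  have "represents (h + 2) a (1 * q * h + r)"
    if q: "q \<le> K" "sum_list a < r" "r < 1 * h" "1 * q * h + r \<le> K * h" for q r
  proof (rule represents_reach)
    have r: "int r = int h - 1" using q S by simp
    have "q \<noteq> K" using q(2,4) by auto
    thus "reach (mset a) (int (1 * Suc q)) (- 1)"
      unfolding a_def using ext k q by (intro reach_multiples) (simp_all add: a_def)
    show "int h * int (1 * Suc q) + - 1 = int (1 * q * h + r)" using r by (simp add: algebra_simps)
  qed
  from covering_criterion[of "[]" k 1 bg K h a N, folded a_def, OF ext k _ _ this _ N] h
  show ?thesis by simp
qed

lemma nonuniversal_node_length:
  fixes h K :: nat
  assumes K: "3 \<le> K" and hK: "3 * K ^ 3 + 20 \<le> h"
    and finite_criterion: "\<And>a. is_form a \<Longrightarrow> (\<And>N. N \<le> K * h \<Longrightarrow> represents (h + 2) a N) \<Longrightarrow> universal (h + 2) a"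
    and node: "esc_node (h + 2) a" and nu: "\<not> universal (h + 2) a"
  shows "length a < h \<and> (3 dvd h \<longrightarrow> length a + 1 < h)"
proof (rule ccontr)
  assume contra: "\<not> ?thesis"
  hence n: "h \<le> length a + 1" by auto
  have K3: "9 * K \<le> K ^ 3"
    using mult_mono[of 9 "K * K" K K] mult_mono[of 3 K 3 K] K by (simp add: power3_eq_cube)
  have h2: "2 \<le> h" using hK by simp
  have form: "is_form a" by (rule esc_node_is_form[OF node])
  have sum: "sum_list a < K * h"
    using finite_criterion[OF form] esc_node_represents_le_sum[OF h2 node] nu by (meson le_trans not_le)
  obtain i where i: "i \<le> length a" "ext_ok 0 (take i a)" "h \<le> i + 1 + K"
    "h \<le> sum_list (take i a) + 2" "i < length a \<longrightarrow> sum_list (take i a) + 2 \<le> a ! i"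
    using longest_ext_ok_prefix[OF h2 node n sum] K by auto
  define p where "p = take i a"
  have len: "length p = i" using i(1) by (simp add: p_def)
  have sub: "mset p \<subseteq># mset a" unfolding p_def by (metis append_take_drop_id mset_append mset_subset_eq_add_left)
  have formp: "is_form p" using form set_take_subset[of i a]
    unfolding p_def is_form_def by (auto intro: sorted_wrt_take)
  hence pos: "\<forall>x\<in>set p. 1 \<le> x" by (simp add: is_form_def)
  have nup: "\<not> universal (h + 2) p" using universal_mono sub nu by blast
  then obtain N where N: "N \<le> K * h" "\<not> represents (h + 2) p N"
    using finite_criterion[OF formp] by blast
  have sump: "sum_list p < K * h"
    using sum append_take_drop_id[of i a] sum_list.append[of "take i a" "drop i a"] by (simp add: p_def)

  \<comment> \<open>The average coefficient is below K + 1, so some value at most K is repeated often.\<close>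
  have "\<exists>v \<le> K. K + 3 \<le> count_list p v"
  proof (rule ccontr)
    assume "\<not> ?thesis"
    hence "count_list p v \<le> K + 2" if "v < K + 1" for v
      using that by (metis Suc_eq_plus1 add_Suc_right less_Suc_eq_le not_less_eq_eq numeral_2_eq_2 numeral_3_eq_3)
    hence "2 * (\<Sum>x\<leftarrow>p. K + 1 - x) \<le> (K + 2) * ((K + 1) * K)"
      using deficit_le[OF pos, of "K + 1" "K + 2"] by (metis add_diff_cancel_right')
    moreover have "(K + 1) * i \<le> sum_list p + (\<Sum>x\<leftarrow>p. K + 1 - x)"
      unfolding len[symmetric] using excess_deficit[of "K + 1" p] by linarith
    moreover have "(K + 1) * h \<le> (K + 1) * (i + 1 + K)" using i(3) by (intro mult_left_mono) auto
    ultimately have "2 * h < 2 * (K + 1) * (K + 1) + (K + 2) * ((K + 1) * K)"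
      using sump by (simp add: algebra_simps)
    \<comment> \<open>Substituting K = 3 + t lets the cubic inequality be compared coefficient by
      coefficient.\<close>
    moreover obtain t where "K = 3 + t" using K le_Suc_ex by blast
    ultimately show False using hK by (simp add: power3_eq_cube algebra_simps)
  qed
  \<comment> \<open>Minimality bounds the multiplicity of every smaller value and thereby the
    deficit \<open>D\<close>.\<close>
  define c where "c = (LEAST v. K + 3 \<le> count_list p v)"
  have ck: "K + 3 \<le> count_list p c" unfolding c_def using \<open>\<exists>v \<le> K. _\<close> by (metis LeastI)
  have cK: "c \<le> K" unfolding c_def using \<open>\<exists>v \<le> K. _\<close> by (metis Least_le le_trans)
  have below: "count_list p v \<le> K + 2" if "v < c" for v
    using not_less_Least[of v "\<lambda>v. K + 3 \<le> count_list p v"] that unfolding c_def by simp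
  define sm k bg where "sm = filter (\<lambda>x. x < c) p" and "k = count_list p c"
    and "bg = filter (\<lambda>x. c < x) p"
  have p: "p = sm @ replicate k c @ bg"
    unfolding sm_def k_def bg_def by (rule sorted_three_way) (use formp in \<open>simp add: is_form_def\<close>)
  have k: "K + 3 \<le> k" using ck by (simp add: k_def)
  have ext: "ext_ok 0 (sm @ replicate k c @ bg)" using i(2) p by (simp add: p_def)
  have "c \<in> set p" using ck by (metis add_is_0 count_notin le_zero_eq numeral_eq_Suc nat.simps(3))
  hence c1: "1 \<le> c" using pos by simp
  have "ext_ok (sum_list sm) (replicate (Suc (k - 1)) c)" using ext k by (simp add: ext_ok_append)
  hence csm: "c \<le> sum_list sm + 1" by simp
  have "c \<noteq> 1"
  proof
    assume "c = 1"
    moreover have "sm = []" unfolding sm_def \<open>c = 1\<close> using pos by (auto simp: filter_empty_conv)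
    ultimately show False
      using ones_cover[of k bg K h N] ext k h2 i(4) N p by (simp add: p_def[symmetric])
  qed
  hence c2: "2 \<le> c" using c1 by simp

  define D E where "D = (\<Sum>x\<leftarrow>p. c - x)" and "E = (\<Sum>x\<leftarrow>p. x - c)"
  have ED: "E + c * i = sum_list p + D" unfolding D_def E_def using excess_deficit[where a = p] len by metis
  have ci: "c * h \<le> c * i + c * (1 + K)"
    using mult_left_mono[OF i(3), of c] by (simp add: algebra_simps)
  have DK: "c * (1 + K) + D \<le> K ^ 3"
  proof -
    have "2 * D \<le> (K + 2) * (c * (c - 1))" unfolding D_def by (rule deficit_le[OF pos below])
    also have "\<dots> \<le> (K + 2) * (K * (K - 1))" using cK by (intro mult_mono) auto
    finally have "2 * D \<le> (K + 2) * (K * (K - 1))" .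
    moreover have "c * (1 + K) \<le> K * (1 + K)" using cK by (intro mult_right_mono) auto
    moreover obtain t where "K = 3 + t" using K le_Suc_ex by blast
    ultimately show ?thesis by (simp add: power3_eq_cube algebra_simps)
  qed
  \<comment> \<open>The sum is at least c i - D, and i >= h - 1 - K, so it falls short of c h by at
    most K^3 <= h - 20.\<close>
  have big_sum: "(c - 1) * h + 20 \<le> sum_list p"
  proof -
    have "(c - 1) * h + h = c * h" using c2 by (cases c) auto
    thus ?thesis using ED ci DK hK by linarith
  qed
  \<comment> \<open>A sum of c h or more would leave no remainder in the gap of
    \<open>covering_criterion\<close>.\<close>
  have lt: "sum_list p < c * h"
  proof (rule ccontr)
    assume "\<not> ?thesis"
    hence "represents (h + 2) p N"
      using covering_criterion[of sm k c bg K h p N] ext k c1 h2 N(1) p by auto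
    thus False using N by simp
  qed
  \<comment> \<open>Now the excess is bounded too, so all but a number of entries bounded in terms
    of K equal c.\<close>
  have EK: "E \<le> c * (1 + K) + D" using ED ci lt by linarith
  have small_big: "length sm \<le> D" "length bg \<le> E" "\<And>b. b \<in> set bg \<Longrightarrow> b \<le> c + E"
  proof -
    have "(\<Sum>x\<leftarrow>sm. 1) \<le> (\<Sum>x\<leftarrow>sm. c - x)" by (rule sum_list_mono) (auto simp: sm_def)
    also have "\<dots> \<le> D" unfolding D_def p by simp
    finally show "length sm \<le> D" by (simp add: sum_list_triv)
    have bgE: "(\<Sum>x\<leftarrow>bg. x - c) \<le> E" unfolding E_def p by simp
    have "(\<Sum>x\<leftarrow>bg. 1) \<le> (\<Sum>x\<leftarrow>bg. x - c)" by (rule sum_list_mono) (auto simp: bg_def)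
    thus "length bg \<le> E" using bgE by (simp add: sum_list_triv)
    fix b assume "b \<in> set bg"
    hence "b - c \<le> (\<Sum>x\<leftarrow>bg. x - c)" by (intro member_le_sum_list) auto
    thus "b \<le> c + E" using bgE by linarith
  qed
  have ilen: "i = length sm + k + length bg" using len p by (metis add.assoc length_append length_replicate)

  have special: "c = 3 \<and> (sm = [1, 1] \<or> sm = [1, 2])"
  proof (rule ccontr)
    assume ns: "\<not> ?thesis"
    have "sorted sm" unfolding sm_def using formp by (simp add: is_form_def sorted_wrt_filter)
    moreover have "\<forall>x\<in>set sm. 1 \<le> x \<and> x < c" unfolding sm_def using pos by simp
    moreover have "ext_ok 0 sm" using ext by (simp add: ext_ok_append)
    ultimately have turn: "turnable sm c" using small_coefficients_turnable csm c2 ns by blast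
    have "b + 10 \<le> sum_list sm + k * c" if "b \<in> set bg" for b
    proof -
      have "k * 2 \<le> k * c" using c2 by (intro mult_left_mono) auto
      thus ?thesis using small_big(1,2) small_big(3)[OF that] ilen i(3) EK DK hK cK K3 by linarith
    qed
    hence "represents (h + 2) p N"
      using turnable_covers[of sm k c bg K h N] ext k h2 turn big_sum N(1) unfolding p by simp
    thus False using N by simp
  qed
  then obtain d where d: "d = 1 \<or> d = 2" and sm: "sm = [1, d]" and c: "c = 3" by blast
  note pd = p[unfolded sm c]
  note extd = ext[unfolded sm c]
  have D: "D = 5 - d"
  proof -
    have "(\<Sum>x\<leftarrow>bg. 3 - x) = 0" by (auto simp: bg_def c)
    thus ?thesis unfolding D_def c pd using d by (auto simp: sum_list_replicate)
  qed
  have h27: "27 * K + 20 \<le> h" using K3 hK by linarith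
  have k3: "2 * h + 6 * K + 2 \<le> 3 * k"
    using ilen i(3) small_big(2) EK h27 K D d unfolding sm c by auto
  have sumd: "2 * h + 20 \<le> sum_list p" using big_sum by (simp add: c)
  have threes: "3 dvd b" if "b \<in> set bg" for b
  proof (rule ccontr)
    assume b: "\<not> 3 dvd b"
    have bK: "b \<le> 3 * K + 10" using small_big(3)[OF that] EK D d by (auto simp: c)
    have "represents (h + 2) p (3 * q * h + r)"
      if q: "q \<le> K" "sum_list p < r" "r < 3 * h" for q r
    proof (rule threes_represent_mixed[OF d b, where k = k])
      show "{#b, 1, d#} + replicate_mset k 3 \<subseteq># mset p"
        unfolding pd using \<open>b \<in> set bg\<close> by (simp add: add_mset_commute)
    qed (use q bK h27 k3 sumd in linarith)+
    hence "represents (h + 2) p N"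
      using covering_criterion[of "[1, d]" k 3 bg K h p N] extd k h2 N(1) pd by simp
    thus False using N by simp
  qed
  obtain N0 where N0: "sum_list p < N0" "N0 \<le> sum_list p + 3" "N0 + 4 \<le> 3 * h" "bad_residue d h N0"
    using pure_threes_gap[of d k bg K h N] d extd k h2 sumd k3 N unfolding pd[symmetric] by auto
  \<comment> \<open>This bounds the truant by the sum + 3, and with it any next coefficient, as
    \<open>exceptional_child_covers\<close> requires.\<close>
  have "\<not> represents (h + 2) (1 # d # replicate k 3 @ bg) N0"
    by (rule not_represents_bad_residue[OF N0(4)]) (use N0 threes pd in auto)
  hence tr: "truant (h + 2) p \<le> N0" using N0(1) pd by (intro truant_le) auto
  show False
  proof (cases "i < length a")
    case True
    have b: "sum_list p + 2 \<le> a ! i" "a ! i \<le> truant (h + 2) p"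
      using i(5) esc_node_take[OF h2 node True] True by (auto simp: p_def)
    have ps: "p @ [a ! i] = take (Suc i) a" using True by (simp add: p_def take_Suc_conv_app_nth)
    have "universal (h + 2) (p @ [a ! i])"
    proof (rule finite_criterion)
      show "is_form (p @ [a ! i])" using form set_take_subset[of "Suc i" a]
        unfolding ps is_form_def by (auto intro: sorted_wrt_take)
      have "represents (h + 2) p N'" if "N' < a ! i" for N'
        using truant_props(3)[OF nup, of N'] that b(2) by (cases "N' = 0") auto
      thus "represents (h + 2) (p @ [a ! i]) N'" if "N' \<le> K * h" for N'
        using exceptional_child_covers[of "[1, d]" k bg K h "a ! i" N'] extd k h2 b tr N0(2) sumd that
        unfolding pd[symmetric] by auto
    qed
    hence "universal (h + 2) a"
      by (rule universal_mono) (metis ps append_take_drop_id mset_append mset_subset_eq_add_left)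
    thus False using nu by simp
  next
    case False
    hence ia: "i = length a" using i(1) by simp
    \<comment> \<open>The excess is nonnegative, so the sum is at least 3 \<open>length a\<close> -
      D; together with sum < N0 <= 3h - 4 this bounds the length.\<close>
    have s3: "3 * length a \<le> sum_list p + (5 - d)" using ED D ia by (simp add: c)
    show False
    proof (cases "d = 1")
      case True
      hence "length a < h" "\<not> 3 dvd h" using s3 N0 by (auto simp: bad_residue_def)
      thus False using contra by simp
    next
      case False
      hence "d = 2" using d by simp
      \<comment> \<open>Sum and N0 are both divisible by 3, so N0 is the sum + 3, which improves the
        bound on the length by one.\<close>
      have "3 dvd sum_list bg" using threes by (induction bg) auto
      moreover have "sum_list p = 3 * (k + 1) + sum_list bg"
        unfolding pd \<open>d = 2\<close> by (simp add: sum_list_replicate)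
      ultimately have "3 dvd sum_list p" by (metis dvd_add dvd_triv_left)
      moreover have "3 dvd N0" using N0(4) \<open>d = 2\<close> by (auto simp: bad_residue_def)
      ultimately have "N0 = sum_list p + 3" using N0(1,2) by presburger
      hence "length a + 1 < h" using s3 N0(3) \<open>d = 2\<close> by linarith
      thus False using contra by simp
    qed
  qed
qed

subsection \<open>Maximal rank\<close>

lemma ext_ok_threes: "d = 1 \<or> d = 2 \<Longrightarrow> ext_ok 0 ([1, d] @ replicate j 3)"
  by (auto simp: ext_ok_append intro!: ext_ok_bounded)

lemma is_form_threes: "d = 1 \<or> d = 2 \<Longrightarrow> is_form ([1, d] @ replicate j 3)"
  by (auto simp: is_form_def sorted_append)

lemma threes_not_universal:
  assumes "bad_residue d h N" "1 + d + 3 * j < N" "N + 3 < 3 * h"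
  shows "\<not> universal (h + 2) ([1, d] @ replicate j 3)"
proof -
  have "\<not> represents (h + 2) ([1, d] @ replicate j 3) N"
    using not_represents_bad_residue[OF assms(1), of "replicate j 3"] assms(2,3)
    by (simp add: sum_list_replicate)
  moreover have "1 \<le> N" using assms(2) by simp
  ultimately show ?thesis unfolding universal_def by blast
qed

lemma threes_node:
  assumes d: "d = 1 \<or> d = 2" and nu: "\<not> universal (h + 2) ([1, d] @ replicate j 3)"
  shows "esc_node (h + 2) ([1, d] @ replicate (Suc j) 3)"
proof (rule esc_node_ext_ok[OF is_form_threes[OF d] ext_ok_threes[OF d]])
  fix i assume "i < length ([1, d] @ replicate (Suc j) 3)"
  moreover have *: "[1, d] @ replicate (Suc j) 3 = ([1, d] @ replicate j 3) @ [3]"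
    by (simp add: replicate_append_same)
  ultimately have "take i ([1, d] @ replicate (Suc j) 3) = take i ([1, d] @ replicate j 3)"
    unfolding * by (subst take_append) simp
  moreover have "mset (take i xs) \<subseteq># mset xs" for xs :: "nat list"
    by (metis append_take_drop_id mset_append mset_subset_eq_add_left)
  ultimately show "\<not> universal (h + 2) (take i ([1, d] @ replicate (Suc j) 3))"
    using universal_mono nu by metis
qed

text \<open>The sum is 3h - 7; the bad class contains 3h - 4 or 3h - 6, according to h modulo
  3.\<close>

lemma ones_threes_not_universal:
  assumes "4 \<le> h" "\<not> 3 dvd h"
  shows "\<not> universal (h + 2) ([1, 1] @ replicate (h - 3) 3)"
proof -
  obtain u where u: "h = 4 + u" using assms(1) le_Suc_ex by blast
  have "h mod 3 = 1 \<or> h mod 3 = 2" using assms(2) by presburger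
  thus ?thesis
  proof
    assume "h mod 3 = 1"
    moreover have "3 * h - 4 = 2 + 3 * (u + 2)" using u by simp
    hence "(3 * h - 4) mod 3 = 2" by (simp only: mod_mult_self2) simp
    ultimately have "bad_residue 1 h (3 * h - 4)" by (simp add: bad_residue_def)
    thus ?thesis by (rule threes_not_universal) (use assms in auto)
  next
    assume "h mod 3 = 2"
    moreover have "3 * h - 6 = 3 * (u + 2)" using u by simp
    ultimately have "bad_residue 1 h (3 * h - 6)" by (simp add: bad_residue_def)
    thus ?thesis by (rule threes_not_universal) (use assms in auto)
  qed
qed

text \<open>The sum is 3h - 9, and 3h - 6 lies in the bad class.\<close>

lemma one_two_threes_not_universal:
  assumes "4 \<le> h" "3 dvd h"
  shows "\<not> universal (h + 2) ([1, 2] @ replicate (h - 4) 3)"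
proof -
  have "3 * h - 6 = 3 * (h - 2)" by simp
  hence "bad_residue 2 h (3 * h - 6)" using assms(2) by (simp add: bad_residue_def)
  thus ?thesis by (rule threes_not_universal) (use assms in auto)
qed

section \<open>Size of the constant C\<close>

lemma criterion_constant_ge_3:
  fixes C :: real
  assumes hC: "\<And>k a. 3 \<le> k \<Longrightarrow> is_form a \<Longrightarrow>
                 (\<And>N. 1 \<le> N \<Longrightarrow> real N \<le> C * (real k - 2) \<Longrightarrow> represents k a N) \<Longrightarrow>
                 universal k a"
  shows "3 \<le> C"
proof (rule ccontr)
  assume "\<not> 3 \<le> C"
  hence "3 - C > 0" by simp
  then obtain q :: nat where q: "6 < real q * (3 - C)" using reals_Archimedean3 by blast
  \<comment> \<open>As h = 1 modulo 3, \<open>?a\<close> is not universal, yet it represents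
    everything up to 3h - 7. The choice of q makes C h smaller than 3h - 6, so the criterion would
    force universality.\<close>
  define h where "h = 3 * (q + 1) + 1"
  let ?a = "[1, 1] @ replicate (h - 3) (3 :: nat)"
  have h: "4 \<le> h" "\<not> 3 dvd h" unfolding h_def by presburger+
  have "\<exists>N. 1 \<le> N \<and> real N \<le> C * real h \<and> \<not> represents (h + 2) ?a N"
  proof (rule ccontr)
    assume none: "\<not> ?thesis"
    have "universal (h + 2) ?a"
    proof (rule hC)
      show "is_form ?a" by (rule is_form_threes) simp
      fix N :: nat assume "1 \<le> N" "real N \<le> C * (real (h + 2) - 2)"
      thus "represents (h + 2) ?a N" using none by auto
    qed (use h in simp)
    thus False using ones_threes_not_universal[OF h] by blast
  qed
  then obtain N where N: "real N \<le> C * real h" "\<not> represents (h + 2) ?a N" by blast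
  have "sum_list ?a < N"
    using represents_le_sum[OF ext_ok_threes[of 1 "h - 3"], of N h] N(2) by linarith
  hence "3 * h \<le> N + 6" using h by (simp add: sum_list_replicate)
  hence "3 * real h \<le> real N + 6" by linarith
  hence "real h * (3 - C) \<le> 6" using N(1) by (simp add: algebra_simps)
  moreover have "real q * (3 - C) \<le> real h * (3 - C)"
    using \<open>3 - C > 0\<close> by (intro mult_right_mono) (auto simp: h_def)
  ultimately show False using q by linarith
qed

text \<open>For K >= 4, C > K - 1 gives m > 6 (K - 1)^2 K, which is large enough. The 22 is 20 + 2
  because m = h + 2.\<close>

lemma threshold_bound:
  fixes C :: real and m K :: nat
  assumes C: "3 \<le> C" and K: "K = nat \<lceil>C\<rceil>" and m: "real m > 6 * C^2 * (C + 1)"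
  shows "3 \<le> K" "3 * K ^ 3 + 22 \<le> m"
proof -
  have KC: "C \<le> real K" "real K < C + 1" unfolding K using C by linarith+
  show K3: "3 \<le> K" using KC C by linarith
  have mono: "6 * x^2 * (x + 1) \<le> 6 * C^2 * (C + 1)" if "0 \<le> x" "x \<le> C" for x :: real
    using that by (intro mult_mono power_mono) auto
  show "3 * K ^ 3 + 22 \<le> m"
  proof (cases "K = 3")
    \<comment> \<open>For K = 3 the estimate by K - 1 gives only 72, so C >= 3 is used instead and
      gives 216.\<close>
    case True
    have "216 \<le> 6 * C^2 * (C + 1)" using mono[of 3] C by simp
    hence "real m > 216" using m by linarith
    thus ?thesis using True by simp
  next
    case False
    hence "4 \<le> K" using K3 by simp
    then obtain t where t: "K = 4 + t" using le_Suc_ex by blast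
    have "6 * (real (3 + t))^2 * (real (3 + t) + 1) < real m"
    proof -
      have "real (3 + t) \<le> C" using KC(2) t by simp
      from mono[OF _ this] m show ?thesis by linarith
    qed
    hence "real (6 * (3 + t)^2 * (3 + t + 1)) < real m" by simp
    hence "6 * (3 + t)^2 * (3 + t + 1) < m" by (simp only: of_nat_less_iff)
    thus ?thesis unfolding t by (simp add: power3_eq_cube power2_eq_square algebra_simps)
  qed
qed

theorem theorem2p3:
  fixes C :: real and m :: nat
  assumes hC: "\<And>k a. 3 \<le> k \<Longrightarrow> is_form a \<Longrightarrow>
                 (\<And>N. 1 \<le> N \<Longrightarrow> real N \<le> C * (real k - 2) \<Longrightarrow> represents k a N) \<Longrightarrow>
                 universal k a"
    and hm3: "3 \<le> m"
    and hm: "real m > 6 * C^2 * (C + 1)"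
  shows "finite (leaf_ranks m) \<and>
         R_max m = (if m mod 3 = 2 then m - 3 else m - 2)"
proof -
  define K h where "K = nat \<lceil>C\<rceil>" and "h = m - 2"
  have m: "m = h + 2" using hm3 by (simp add: h_def)
  have C3: "3 \<le> C" by (rule criterion_constant_ge_3[OF hC])
  note K = threshold_bound[OF C3 K_def hm]
  have hK: "3 * K ^ 3 + 20 \<le> h" using K(2) m by simp
  have CK: "C \<le> real K" unfolding K_def by linarith
  have crit: "universal (h + 2) a"
    if "is_form a" "\<And>N. N \<le> K * h \<Longrightarrow> represents (h + 2) a N" for a
  proof (rule hC[OF _ that(1)])
    fix N :: nat assume "real N \<le> C * (real (h + 2) - 2)"
    also have "\<dots> \<le> real K * real h" using CK by (simp add: mult_right_mono)
    finally have "N \<le> K * h" by (simp flip: of_nat_mult)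
    thus "represents (h + 2) a N" by (rule that(2))
  qed (use hK in simp)
  note bound = nonuniversal_node_length[OF K(1) hK crit]
  define R where "R = (if 3 dvd h then h - 1 else h)"
  have h4: "4 \<le> h" using hK by simp
  \<comment> \<open>A nonempty leaf extends a non-universal node by one coefficient, so its rank is
    at most one above the bound for such nodes.\<close>
  have le: "length a \<le> R" if "esc_leaf m a" for a
  proof -
    have "esc_node (h + 2) a" using that m by (simp add: esc_leaf_def)
    thus ?thesis
    proof cases
      case (child b x)
      thus ?thesis using bound[of b] by (auto simp: R_def)
    qed simp
  qed
  have "\<exists>a. esc_leaf m a \<and> length a = R"
  proof (cases "3 dvd h")
    case True
    let ?a = "[1, 2] @ replicate (Suc (h - 4)) (3 :: nat)"
    have "esc_node (h + 2) ?a" using threes_node[OF _ one_two_threes_not_universal[OF h4 True]] by simp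
    moreover have "length ?a = R" using True h4 by (simp add: R_def)
    \<comment> \<open>Universality follows from the rank alone, since non-universal nodes are
      shorter than \<open>R\<close>.\<close>
    moreover have "universal (h + 2) ?a"
      using bound[of ?a] calculation True by (auto simp: R_def)
    ultimately show ?thesis unfolding m esc_leaf_def by blast
  next
    case False
    let ?a = "[1, 1] @ replicate (Suc (h - 3)) (3 :: nat)"
    have "esc_node (h + 2) ?a" using threes_node[OF _ ones_threes_not_universal[OF h4 False]] by simp
    moreover have "length ?a = R" using False h4 by (simp add: R_def)
    moreover have "universal (h + 2) ?a"
      using bound[of ?a] calculation False by (auto simp: R_def)
    ultimately show ?thesis unfolding m esc_leaf_def by blast
  qed
  hence "R \<in> leaf_ranks m" by (auto simp: leaf_ranks_def)
  moreover have sub: "leaf_ranks m \<subseteq> {..R}" using le by (auto simp: leaf_ranks_def)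
  moreover have fin: "finite (leaf_ranks m)" using sub finite_subset by blast
  ultimately have "R_max m = R" unfolding R_max_def by (intro Max_eqI) auto
  moreover have "3 dvd h \<longleftrightarrow> m mod 3 = 2" unfolding m by presburger
  hence "R = (if m mod 3 = 2 then m - 3 else m - 2)" by (simp add: R_def m)
  ultimately show ?thesis using fin by simp
qed

end
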